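(* Every Sugihara monoid is representable; that is, every Sugihara monoid is isomorphic to the direct reduct of some representable distributive involutive FL-algebra.
   Context: A Sugihara monoid is an algebra $\langle A,\wedge,\vee,\cdot,\to,1,{\sim}\rangle$ such that $\langle A,\wedge,\vee,\cdot,\to,1\rangle$ is a commutative, distributive, idempotent ($a\cdot a=a$) residuated lattice (with $a\cdot b\le c\iff b\le a\to c$) satisfying ${\sim}{\sim}a=a$ and $a\to{\sim}b=b\to{\sim}a$. A distributive involutive FL-algebra (DInFL-algebra) is a distributive residuated lattice $\langle A,\wedge,\vee,\cdot,1,\backslash,/\rangle$ with a distinguished element $0$ such that ${\sim}a:=a\backslash 0$ and $-a:=0/a$ satisfy $-{\sim}a=a={\sim}{-}a$; it is regarded in the signature $\langle A,\wedge,\vee,\cdot,1,{\sim},-\rangle$. Its direct reduct is $\langle A,\wedge,\vee,\cdot,\to,1,{\sim}\rangle$ where $a\to b:={\sim}(-b\cdot a)$. Concrete algebras: let $\mathbf X=\langle X,\le\rangle$ be a poset, $E$ an equivalence relation on $X$ with ${\le}\subseteq E$, and $\alpha:X\to X$ an order automorphism of $\mathbf X$ with $\alpha\subseteq E$ (as a relation). Order $E$ by $(u,v)\preceq(x,y)$ iff $x\le u$ and $v\le y$. Let $\mathsf{Up}(\langle E,\preceq\rangle)$ be the set of upsets. For $R\subseteq E$ write $R^c=E\setminus R$, $R^\smile$ for the converse, and $R\circ S$ for relational composition. Then $\mathfrak D(\mathbf E)=\langle \mathsf{Up}(\langle E,\preceq\rangle),\cap,\cup,\circ,\le,{\sim},-\rangle$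 with ${\sim}R=R^{c\smile}\circ\alpha$ and $-R=\alpha\circ R^{c\smile}$ is a DInFL-algebra (with $0=\alpha\circ{\le}^{c\smile}$). A DInFL-algebra is representable if it is isomorphic to a subalgebra of some such $\mathfrak D(\mathbf E)$ (equivalently, it lies in $\mathbb{ISP}$ of the algebras $\mathfrak D(\mathbf E)$ with $E=X^2$). A Sugihara monoid is representable if it is isomorphic to the direct reduct of a representable DInFL-algebra. *)

theory Defs
  imports "HOL-Algebra.Group"
begin

section \<open>Algebras\<close>

record 'a lat_monoid = "'a monoid" +
  lmeet :: "'a \<Rightarrow> 'a \<Rightarrow> 'a" (infixl "\<curlywedge>\<index>" 65)
  ljoin :: "'a \<Rightarrow> 'a \<Rightarrow> 'a" (infixl "\<curlyvee>\<index>" 65)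

abbreviation lat_le :: "('a, 'm) lat_monoid_scheme \<Rightarrow> 'a \<Rightarrow> 'a \<Rightarrow> bool" (infix "\<preceq>\<index>" 50)
  where "x \<preceq>\<^bsub>A\<^esub> y \<equiv> x \<curlywedge>\<^bsub>A\<^esub> y = x"

locale distributive_lattice_monoid = monoid A for A (structure) +
  assumes meet_closed: "\<lbrakk>x \<in> carrier A; y \<in> carrier A\<rbrakk> \<Longrightarrow> x \<curlywedge> y \<in> carrier A"
    and join_closed: "\<lbrakk>x \<in> carrier A; y \<in> carrier A\<rbrakk> \<Longrightarrow> x \<curlyvee> y \<in> carrier A"
    and meet_comm: "\<lbrakk>x \<in> carrier A; y \<in> carrier A\<rbrakk> \<Longrightarrow> x \<curlywedge> y = y \<curlywedge> x"
    and join_comm: "\<lbrakk>x \<in> carrier A; y \<in> carrier A\<rbrakk> \<Longrightarrow> x \<curlyvee> y = y \<curlyvee> x"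
    and meet_assoc: "\<lbrakk>x \<in> carrier A; y \<in> carrier A; z \<in> carrier A\<rbrakk>
                       \<Longrightarrow> (x \<curlywedge> y) \<curlywedge> z = x \<curlywedge> (y \<curlywedge> z)"
    and join_assoc: "\<lbrakk>x \<in> carrier A; y \<in> carrier A; z \<in> carrier A\<rbrakk>
                       \<Longrightarrow> (x \<curlyvee> y) \<curlyvee> z = x \<curlyvee> (y \<curlyvee> z)"
    and meet_absorb: "\<lbrakk>x \<in> carrier A; y \<in> carrier A\<rbrakk> \<Longrightarrow> x \<curlywedge> (x \<curlyvee> y) = x"
    and join_absorb: "\<lbrakk>x \<in> carrier A; y \<in> carrier A\<rbrakk> \<Longrightarrow> x \<curlyvee> (x \<curlywedge> y) = x"
    and meet_join_distrib: "\<lbrakk>x \<in> carrier A; y \<in> carrier A; z \<in> carrier A\<rbrakk>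
                              \<Longrightarrow> x \<curlywedge> (y \<curlyvee> z) = (x \<curlywedge> y) \<curlyvee> (x \<curlywedge> z)"

record 'a sugihara_sig = "'a lat_monoid" +
  imp :: "'a \<Rightarrow> 'a \<Rightarrow> 'a"
  inv_neg :: "'a \<Rightarrow> 'a"

locale sugihara_monoid = distributive_lattice_monoid A + comm_monoid A for A (structure) +
  assumes imp_closed: "\<lbrakk>a \<in> carrier A; b \<in> carrier A\<rbrakk> \<Longrightarrow> imp A a b \<in> carrier A"
    and inv_neg_closed: "a \<in> carrier A \<Longrightarrow> inv_neg A a \<in> carrier A"
    and idempotent: "a \<in> carrier A \<Longrightarrow> a \<otimes> a = a"
    and residuation: "\<lbrakk>a \<in> carrier A; b \<in> carrier A; c \<in> carrier A\<rbrakk>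
                        \<Longrightarrow> a \<otimes> b \<preceq> c \<longleftrightarrow> b \<preceq> imp A a c"
    and inv_neg_inv_neg: "a \<in> carrier A \<Longrightarrow> inv_neg A (inv_neg A a) = a"
    and contraposition: "\<lbrakk>a \<in> carrier A; b \<in> carrier A\<rbrakk>
                           \<Longrightarrow> imp A a (inv_neg A b) = imp A b (inv_neg A a)"

text \<open>\<open>ld a c\<close> is the left residual \<open>a\c\<close> and \<open>rd c b\<close> is the right residual \<open>c/b\<close>.\<close>

locale distributive_residuated_lattice = distributive_lattice_monoid A
  for A (structure) and ld rd :: "'a \<Rightarrow> 'a \<Rightarrow> 'a" +
  assumes ld_closed: "\<lbrakk>a \<in> carrier A; c \<in> carrier A\<rbrakk> \<Longrightarrow> ld a c \<in> carrier A"
    and rd_closed: "\<lbrakk>c \<in> carrier A; b \<in> carrier A\<rbrakk> \<Longrightarrow> rd c b \<in> carrier A"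
    and ld_residuation: "\<lbrakk>a \<in> carrier A; b \<in> carrier A; c \<in> carrier A\<rbrakk>
                           \<Longrightarrow> a \<otimes> b \<preceq> c \<longleftrightarrow> b \<preceq> ld a c"
    and rd_residuation: "\<lbrakk>a \<in> carrier A; b \<in> carrier A; c \<in> carrier A\<rbrakk>
                           \<Longrightarrow> a \<otimes> b \<preceq> c \<longleftrightarrow> a \<preceq> rd c b"

record 'a dinfl_sig = "'a lat_monoid" +
  tilde :: "'a \<Rightarrow> 'a"
  minus_neg :: "'a \<Rightarrow> 'a"

text \<open>DInFL-algebras live in the signature without residuals and without \<open>0\<close>; these are
  unique when they exist, and are recovered from the two negations.\<close>

definition dinfl_algebra :: "('a, 'm) dinfl_sig_scheme \<Rightarrow> bool" where
  "dinfl_algebra A \<longleftrightarrow>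
     (\<exists>ld rd. distributive_residuated_lattice A ld rd \<and>
        (\<exists>z \<in> carrier A. \<forall>a \<in> carrier A. tilde A a = ld a z \<and> minus_neg A a = rd z a)) \<and>
     (\<forall>a \<in> carrier A. minus_neg A (tilde A a) = a \<and> tilde A (minus_neg A a) = a)"

definition direct_reduct :: "('a, 'm) dinfl_sig_scheme \<Rightarrow> 'a sugihara_sig" where
  "direct_reduct A =
     \<lparr> carrier = carrier A, mult = mult A, one = one A, lmeet = lmeet A, ljoin = ljoin A,
       imp = (\<lambda>a b. tilde A (minus_neg A b \<otimes>\<^bsub>A\<^esub> a)),
       inv_neg = tilde A \<rparr>"

section \<open>Isomorphisms and subalgebras\<close>

definition lat_monoid_iso ::
    "('a, 'm) lat_monoid_scheme \<Rightarrow> ('b, 'n) lat_monoid_scheme \<Rightarrow> ('a \<Rightarrow> 'b) set" where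
  "lat_monoid_iso A B = {f \<in> iso A B. f \<one>\<^bsub>A\<^esub> = \<one>\<^bsub>B\<^esub> \<and>
     (\<forall>x \<in> carrier A. \<forall>y \<in> carrier A.
        f (x \<curlywedge>\<^bsub>A\<^esub> y) = f x \<curlywedge>\<^bsub>B\<^esub> f y \<and> f (x \<curlyvee>\<^bsub>A\<^esub> y) = f x \<curlyvee>\<^bsub>B\<^esub> f y)}"

definition sugihara_iso ::
    "('a, 'm) sugihara_sig_scheme \<Rightarrow> ('b, 'n) sugihara_sig_scheme \<Rightarrow> ('a \<Rightarrow> 'b) set" where
  "sugihara_iso A B = {f \<in> lat_monoid_iso A B.
     (\<forall>x \<in> carrier A. \<forall>y \<in> carrier A. f (imp A x y) = imp B (f x) (f y)) \<and>
     (\<forall>x \<in> carrier A. f (inv_neg A x) = inv_neg B (f x))}"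

definition dinfl_iso ::
    "('a, 'm) dinfl_sig_scheme \<Rightarrow> ('b, 'n) dinfl_sig_scheme \<Rightarrow> ('a \<Rightarrow> 'b) set" where
  "dinfl_iso A B = {f \<in> lat_monoid_iso A B.
     \<forall>x \<in> carrier A. f (tilde A x) = tilde B (f x) \<and> f (minus_neg A x) = minus_neg B (f x)}"

definition dinfl_subalgebra :: "'a set \<Rightarrow> ('a, 'm) dinfl_sig_scheme \<Rightarrow> bool" where
  "dinfl_subalgebra S A \<longleftrightarrow> S \<subseteq> carrier A \<and> \<one>\<^bsub>A\<^esub> \<in> S \<and>
     (\<forall>x \<in> S. \<forall>y \<in> S. x \<otimes>\<^bsub>A\<^esub> y \<in> S \<and> x \<curlywedge>\<^bsub>A\<^esub> y \<in> S \<and> x \<curlyvee>\<^bsub>A\<^esub> y \<in> S) \<and>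
     (\<forall>x \<in> S. tilde A x \<in> S \<and> minus_neg A x \<in> S)"

section \<open>The concrete algebras and representability\<close>

definition order_automorphism :: "'x set \<Rightarrow> 'x rel \<Rightarrow> ('x \<Rightarrow> 'x) \<Rightarrow> bool" where
  "order_automorphism X leq \<alpha> \<longleftrightarrow> bij_betw \<alpha> X X \<and>
     (\<forall>x \<in> X. \<forall>y \<in> X. (x, y) \<in> leq \<longleftrightarrow> (\<alpha> x, \<alpha> y) \<in> leq)"

definition graph_on :: "'x set \<Rightarrow> ('x \<Rightarrow> 'x) \<Rightarrow> 'x rel" where
  "graph_on X \<alpha> = {(x, \<alpha> x) | x. x \<in> X}"

definition dinfl_frame :: "'x set \<Rightarrow> 'x rel \<Rightarrow> 'x rel \<Rightarrow> ('x \<Rightarrow> 'x) \<Rightarrow> bool" where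
  "dinfl_frame X leq E \<alpha> \<longleftrightarrow> partial_order_on X leq \<and> equiv X E \<and> leq \<subseteq> E \<and>
     order_automorphism X leq \<alpha> \<and> graph_on X \<alpha> \<subseteq> E"

definition rel_upsets :: "'x rel \<Rightarrow> 'x rel \<Rightarrow> 'x rel set" where
  "rel_upsets leq E = {R. R \<subseteq> E \<and>
     (\<forall>u v x y. (u, v) \<in> R \<and> (x, y) \<in> E \<and> (x, u) \<in> leq \<and> (v, y) \<in> leq \<longrightarrow> (x, y) \<in> R)}"

definition concrete_dinfl ::
    "'x set \<Rightarrow> 'x rel \<Rightarrow> 'x rel \<Rightarrow> ('x \<Rightarrow> 'x) \<Rightarrow> 'x rel dinfl_sig" where
  "concrete_dinfl X leq E \<alpha> =
     \<lparr> carrier = rel_upsets leq E, mult = (O), one = leq, lmeet = (\<inter>), ljoin = (\<union>),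
       tilde = (\<lambda>R. (E - R)\<inverse> O graph_on X \<alpha>),
       minus_neg = (\<lambda>R. graph_on X \<alpha> O (E - R)\<inverse>) \<rparr>"

definition representable_over :: "'x itself \<Rightarrow> ('a, 'm) dinfl_sig_scheme \<Rightarrow> bool" where
  "representable_over _ A \<longleftrightarrow> dinfl_algebra A \<and>
     (\<exists>(X :: 'x set) leq E \<alpha> S h. dinfl_frame X leq E \<alpha> \<and>
        dinfl_subalgebra S (concrete_dinfl X leq E \<alpha>) \<and>
        h \<in> dinfl_iso A ((concrete_dinfl X leq E \<alpha>)\<lparr>carrier := S\<rparr>))"

text \<open>HOL cannot quantify over the type of points, so one large enough for \<open>A\<close> is fixed.
  Nothing is lost: a representation of \<open>A\<close> is a model of a first-order theory over the points, with
  binary relation symbols for \<open>\<le>\<close>, \<open>E\<close>, (the graph of) \<open>\<alpha>\<close> and each element of \<open>A\<close>, so by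
  downward Loewenheim-Skolem any representation can be replaced by one with at most
  \<open>max \<bar>A\<bar> \<aleph>\<^sub>0\<close> points, and these fit into the type of lists below.\<close>

definition representable :: "('a, 'm) dinfl_sig_scheme \<Rightarrow> bool" where
  "representable A \<longleftrightarrow> representable_over TYPE(('a \<times> nat) list) A"

text \<open>The type of \<open>D\<close> is no restriction, since \<open>D\<close> can be transported along the isomorphism.\<close>

definition sugihara_representable :: "('a, 'm) sugihara_sig_scheme \<Rightarrow> bool" where
  "sugihara_representable A \<longleftrightarrow>
     (\<exists>D :: 'a dinfl_sig. representable D \<and> sugihara_iso A (direct_reduct D) \<noteq> {})"

end

theory Submission
  imports Defs "HOL-Library.Countable"
begin

text \<open>Sugihara monoids are semilinear, so a prime filter \<open>F\<close> containing \<open>1\<close> makes \<open>a \<rightarrow> b \<in> F\<close>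
  a total preorder on \<open>A\<close>, i.e. a homomorphism onto a Sugihara chain, and these homomorphisms
  separate points. A chain is represented on the finitely supported rational functions of its
  elements above \<open>1\<close>, ordered lexicographically with larger elements more significant:
  \<open>c \<ge> 1\<close> becomes the total preorder that only looks at the coordinates above \<open>c\<close>, and \<open>\<sim>c\<close> the
  corresponding strict order. Density of the rationals gives \<open>\<sim>c \<cdot> \<sim>c = \<sim>c\<close>. If \<open>\<sim>1 = 1\<close>, a least
  significant integer coordinate, decremented by \<open>\<alpha>\<close>, makes the order its own negation; otherwise
  \<open>\<alpha>\<close> is the identity. The disjoint union over all pairs \<open>a \<not>\<le> b\<close> represents \<open>A\<close>.\<close>

section \<open>Lattice order and prime filters\<close>

context distributive_lattice_monoid
begin

lemma le_refl: "x \<in> carrier A \<Longrightarrow> x \<preceq> x"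
  by (metis join_absorb meet_absorb meet_closed)

lemma le_antisym: "\<lbrakk>x \<in> carrier A; y \<in> carrier A; x \<preceq> y; y \<preceq> x\<rbrakk> \<Longrightarrow> x = y"
  by (metis meet_comm)

lemma le_trans:
  "\<lbrakk>x \<in> carrier A; y \<in> carrier A; z \<in> carrier A; x \<preceq> y; y \<preceq> z\<rbrakk> \<Longrightarrow> x \<preceq> z"
  by (metis meet_assoc)

lemma meet_le1: "\<lbrakk>x \<in> carrier A; y \<in> carrier A\<rbrakk> \<Longrightarrow> x \<curlywedge> y \<preceq> x"
  by (metis le_refl meet_assoc meet_closed meet_comm)

lemma meet_le2: "\<lbrakk>x \<in> carrier A; y \<in> carrier A\<rbrakk> \<Longrightarrow> x \<curlywedge> y \<preceq> y"
  by (metis le_refl meet_assoc)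

lemma meet_le_coboundedI1:
  "\<lbrakk>x \<in> carrier A; y \<in> carrier A; z \<in> carrier A; x \<preceq> z\<rbrakk> \<Longrightarrow> x \<curlywedge> y \<preceq> z"
  by (metis meet_assoc meet_comm)

lemma meet_le_coboundedI2:
  "\<lbrakk>x \<in> carrier A; y \<in> carrier A; z \<in> carrier A; y \<preceq> z\<rbrakk> \<Longrightarrow> x \<curlywedge> y \<preceq> z"
  by (metis meet_assoc)

lemma le_meetI:
  "\<lbrakk>x \<in> carrier A; y \<in> carrier A; z \<in> carrier A; z \<preceq> x; z \<preceq> y\<rbrakk> \<Longrightarrow> z \<preceq> x \<curlywedge> y"
  by (metis meet_assoc)

lemma le_join1: "\<lbrakk>x \<in> carrier A; y \<in> carrier A\<rbrakk> \<Longrightarrow> x \<preceq> x \<curlyvee> y"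
  by (rule meet_absorb)

lemma le_join2: "\<lbrakk>x \<in> carrier A; y \<in> carrier A\<rbrakk> \<Longrightarrow> y \<preceq> x \<curlyvee> y"
  by (metis meet_absorb join_comm)

lemma join_leI:
  assumes "x \<in> carrier A" "y \<in> carrier A" "z \<in> carrier A" "x \<preceq> z" "y \<preceq> z"
  shows "x \<curlyvee> y \<preceq> z"
  by (metis assms join_closed meet_comm meet_join_distrib)

end

text \<open>\<open>\<one>\<close> is required because membership will be read as lying at or above
  the unit of a quotient chain. The whole carrier counts as prime.\<close>

definition prime_filter :: "('a, 'm) lat_monoid_scheme \<Rightarrow> 'a set \<Rightarrow> bool" where
  "prime_filter A F \<longleftrightarrow> F \<subseteq> carrier A \<and> \<one>\<^bsub>A\<^esub> \<in> F \<and>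
     (\<forall>x \<in> F. \<forall>y \<in> carrier A. x \<preceq>\<^bsub>A\<^esub> y \<longrightarrow> y \<in> F) \<and>
     (\<forall>x \<in> F. \<forall>y \<in> F. x \<curlywedge>\<^bsub>A\<^esub> y \<in> F) \<and>
     (\<forall>x \<in> carrier A. \<forall>y \<in> carrier A. x \<curlyvee>\<^bsub>A\<^esub> y \<in> F \<longrightarrow> x \<in> F \<or> y \<in> F)"

context distributive_lattice_monoid
begin

text \<open>Zorn's lemma gives a filter maximal among those containing \<open>\<one>\<close> and
  omitting \<open>c\<close>. Distributivity makes it prime: two elements outside it are each pushed
  below \<open>c\<close> by a meet with some member, hence so is their join.\<close>

lemma ex_prime_filter:
  assumes c: "c \<in> carrier A" and nle: "\<not> \<one> \<preceq> c"
  shows "\<exists>F. prime_filter A F \<and> c \<notin> F"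
proof -
  define filt where "filt = {F. F \<subseteq> carrier A \<and> \<one> \<in> F \<and> c \<notin> F \<and>
     (\<forall>x \<in> F. \<forall>y \<in> carrier A. x \<preceq> y \<longrightarrow> y \<in> F) \<and> (\<forall>x \<in> F. \<forall>y \<in> F. x \<curlywedge> y \<in> F)}"
  \<comment> \<open>The principal filter of \<open>\<one>\<close> is a first candidate; it omits
    \<open>c\<close> by \<open>nle\<close>.\<close>
  have "{y \<in> carrier A. \<one> \<preceq> y} \<in> filt"
    unfolding filt_def using nle
    by (blast intro: le_refl le_meetI meet_closed one_closed dest: le_trans[OF one_closed])
  hence ne: "filt \<noteq> {}" by blast
  have chain: "\<Union>C \<in> filt" if "C \<noteq> {}" "subset.chain filt C" for C
  proof -
    have sub: "F \<in> filt" if "F \<in> C" for F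
      using \<open>subset.chain filt C\<close> that by (auto simp: subset_chain_def)
    have meet: "x \<curlywedge> y \<in> \<Union>C" if xy: "x \<in> \<Union>C" "y \<in> \<Union>C" for x y
    proof -
      obtain F G where "F \<in> C" "G \<in> C" "x \<in> F" "y \<in> G" using xy by blast
      moreover have "F \<subseteq> G \<or> G \<subseteq> F"
        using \<open>subset.chain filt C\<close> calculation by (auto simp: subset_chain_def)
      ultimately obtain H where "H \<in> C" "x \<in> H" "y \<in> H" by blast
      thus ?thesis using sub[of H] unfolding filt_def by blast
    qed
    have "\<Union>C \<subseteq> carrier A" "\<one> \<in> \<Union>C" "c \<notin> \<Union>C"
      "\<forall>x \<in> \<Union>C. \<forall>y \<in> carrier A. x \<preceq> y \<longrightarrow> y \<in> \<Union>C"
      using sub \<open>C \<noteq> {}\<close> unfolding filt_def by blast+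
    thus ?thesis using meet unfolding filt_def by blast
  qed
  obtain M where M: "M \<in> filt" and max: "\<And>G. \<lbrakk>G \<in> filt; M \<subseteq> G\<rbrakk> \<Longrightarrow> G = M"
    using subset_Zorn_nonempty[OF ne chain] by blast
  have MC: "M \<subseteq> carrier A" and M1: "\<one> \<in> M" and Mc: "c \<notin> M"
    and Mup: "\<And>x y. \<lbrakk>x \<in> M; y \<in> carrier A; x \<preceq> y\<rbrakk> \<Longrightarrow> y \<in> M"
    and Mmeet: "\<And>x y. \<lbrakk>x \<in> M; y \<in> M\<rbrakk> \<Longrightarrow> x \<curlywedge> y \<in> M"
    using M unfolding filt_def by blast+
  have below: "\<exists>m \<in> M. m \<curlywedge> a \<preceq> c" if a: "a \<in> carrier A" "a \<notin> M" for a
  proof (rule ccontr)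
    assume contra: "\<not> ?thesis"
    \<comment> \<open>The filter generated by \<open>M\<close> and \<open>a\<close>. If it omitted
      \<open>c\<close>, maximality would force \<open>a\<close> into \<open>M\<close>.\<close>
    define G where "G = {y \<in> carrier A. \<exists>m \<in> M. m \<curlywedge> a \<preceq> y}"
    have GM: "M \<subseteq> G"
      unfolding G_def using MC a by (auto intro!: bexI intro: meet_le1)
    have aG: "a \<in> G"
      unfolding G_def using MC M1 a by (auto intro!: bexI[OF _ M1] meet_le2)
    have "y \<in> G" if xy: "x \<in> G" "y \<in> carrier A" "x \<preceq> y" for x y
    proof -
      obtain m where m: "m \<in> M" "m \<curlywedge> a \<preceq> x" "x \<in> carrier A"
        using xy unfolding G_def by blast
      have "m \<curlywedge> a \<preceq> y"
        by (rule le_trans[OF _ _ _ m(2) xy(3)]) (use m MC a xy in \<open>auto intro: meet_closed\<close>)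
      thus ?thesis using m xy unfolding G_def by blast
    qed
    moreover have "x \<curlywedge> y \<in> G" if xy: "x \<in> G" "y \<in> G" for x y
    proof -
      obtain m n where mn: "m \<in> M" "n \<in> M" "m \<curlywedge> a \<preceq> x" "n \<curlywedge> a \<preceq> y" "x \<in> carrier A" "y \<in> carrier A"
        using xy unfolding G_def by blast
      have mnC: "m \<in> carrier A" "n \<in> carrier A" using mn MC by auto
      let ?p = "(m \<curlywedge> n) \<curlywedge> a"
      have p: "?p \<in> carrier A" using mnC a by (simp add: meet_closed)
      have pa: "?p \<preceq> a" and pm: "?p \<preceq> m" and pn: "?p \<preceq> n"
        using mnC a p
        by (auto intro!: meet_le2 meet_closed meet_le_coboundedI1 meet_le1)
      have "?p \<preceq> m \<curlywedge> a" "?p \<preceq> n \<curlywedge> a"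
        using mnC a p pa pm pn by (auto intro: le_meetI)
      hence "?p \<preceq> x" "?p \<preceq> y"
        using le_trans[OF p _ _ _ mn(3)] le_trans[OF p _ _ _ mn(4)] mn mnC a
        by (simp_all add: meet_closed)
      hence "?p \<preceq> x \<curlywedge> y" using mn p by (auto intro: le_meetI)
      moreover have "m \<curlywedge> n \<in> M" using mn Mmeet by blast
      ultimately show ?thesis unfolding G_def using mn by (auto intro: meet_closed)
    qed
    moreover have "c \<notin> G" using contra unfolding G_def by blast
    moreover have "G \<subseteq> carrier A" unfolding G_def by blast
    ultimately have "G \<in> filt" unfolding filt_def using GM M1 by blast
    with max GM aG a show False by blast
  qed
  have "a \<in> M \<or> b \<in> M" if ab: "a \<in> carrier A" "b \<in> carrier A" "a \<curlyvee> b \<in> M" for a b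
  proof (rule ccontr)
    assume "\<not> ?thesis"
    then obtain m n where m: "m \<in> M" "m \<curlywedge> a \<preceq> c" and n: "n \<in> M" "n \<curlywedge> b \<preceq> c"
      using below ab by blast
    have mnC: "m \<in> carrier A" "n \<in> carrier A" using m n MC by auto
    let ?k = "m \<curlywedge> n"
    have k: "?k \<in> M" "?k \<in> carrier A" using m n Mmeet MC by blast+
    have "?k \<curlywedge> a \<preceq> c"
    proof -
      have "?k \<curlywedge> a \<preceq> m \<curlywedge> a"
        using mnC ab k
        by (intro le_meetI meet_le_coboundedI1 meet_le1 meet_le2) (auto intro: meet_closed)
      thus ?thesis using mnC ab k c by (intro le_trans[OF _ _ _ _ m(2)]) (auto intro: meet_closed)
    qed
    moreover have "?k \<curlywedge> b \<preceq> c"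
    proof -
      have "?k \<curlywedge> b \<preceq> n \<curlywedge> b"
        using mnC ab k
        by (intro le_meetI meet_le_coboundedI1 meet_le2 meet_le2) (auto intro: meet_closed)
      thus ?thesis using mnC ab k c by (intro le_trans[OF _ _ _ _ n(2)]) (auto intro: meet_closed)
    qed
    ultimately have "?k \<curlywedge> (a \<curlyvee> b) \<preceq> c"
      using k ab c by (simp add: meet_join_distrib join_leI meet_closed)
    thus False using Mup[OF Mmeet[OF k(1) ab(3)] c] Mc by blast
  qed
  hence "prime_filter A M" 
    unfolding prime_filter_def using MC M1 Mup Mmeet by (intro conjI ballI impI) assumption+
  with Mc show ?thesis by blast
qed

end

section \<open>Arithmetic of Sugihara monoids\<close>

context sugihara_monoid
begin

abbreviation arrow (infixr \<open>\<leadsto>\<close> 60) where "a \<leadsto> b \<equiv> imp A a b"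
abbreviation neg (\<open>\<sim>_\<close> [80] 80) where "\<sim>a \<equiv> inv_neg A a"

lemmas closed = m_closed one_closed meet_closed join_closed imp_closed inv_neg_closed

lemma mult_mono_right:
  assumes "a \<in> carrier A" "b \<in> carrier A" "c \<in> carrier A" "b \<preceq> c"
  shows "a \<otimes> b \<preceq> a \<otimes> c"
proof -
  have "c \<preceq> a \<leadsto> a \<otimes> c" using assms residuation[of a c "a \<otimes> c"] by (simp add: le_refl)
  hence "b \<preceq> a \<leadsto> a \<otimes> c" using assms by (blast intro: closed le_trans)
  thus ?thesis using assms residuation[of a b "a \<otimes> c"] by (simp add: closed)
qed

lemma mult_mono:
  assumes "a \<in> carrier A" "b \<in> carrier A" "c \<in> carrier A" "d \<in> carrier A" "a \<preceq> b" "c \<preceq> d"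
  shows "a \<otimes> c \<preceq> b \<otimes> d"
proof -
  have "a \<otimes> c \<preceq> a \<otimes> d" using assms by (blast intro: mult_mono_right)
  moreover have "a \<otimes> d \<preceq> b \<otimes> d"
    using assms mult_mono_right[of d a b] by (simp add: m_comm)
  ultimately show ?thesis using assms by (blast intro: closed le_trans)
qed

lemma eq_by_lower_bounds:
  assumes "x \<in> carrier A" "y \<in> carrier A"
    and "\<And>z. z \<in> carrier A \<Longrightarrow> z \<preceq> x \<longleftrightarrow> z \<preceq> y"
  shows "x = y"
  using assms le_refl le_antisym by blast

lemma one_imp: "a \<in> carrier A \<Longrightarrow> \<one> \<leadsto> a = a"
  using residuation[of \<one> _ a] by (intro eq_by_lower_bounds) (auto simp: closed)

lemma mult_imp_le: "\<lbrakk>a \<in> carrier A; b \<in> carrier A\<rbrakk> \<Longrightarrow> a \<otimes> (a \<leadsto> b) \<preceq> b"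
  by (simp add: residuation le_refl closed)

lemma one_le_imp_iff: "\<lbrakk>a \<in> carrier A; b \<in> carrier A\<rbrakk> \<Longrightarrow> \<one> \<preceq> a \<leadsto> b \<longleftrightarrow> a \<preceq> b"
  using residuation[of a \<one> b] by (simp add: closed)

text \<open>Contraposition against \<open>\<one>\<close> shows that \<open>\<sim>\<one>\<close> is
  the constant 0: negation is residuation into it.\<close>

lemma imp_neg_one: "a \<in> carrier A \<Longrightarrow> a \<leadsto> \<sim>\<one> = \<sim>a"
  using contraposition[of a \<one>] by (simp add: one_imp closed)

lemma le_neg_iff: "\<lbrakk>a \<in> carrier A; b \<in> carrier A\<rbrakk> \<Longrightarrow> b \<preceq> \<sim>a \<longleftrightarrow> a \<otimes> b \<preceq> \<sim>\<one>"
  using residuation[of a b "\<sim>\<one>"] by (simp add: imp_neg_one closed)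

text \<open>For both sides, lying above \<open>z\<close> amounts to
  \<open>\<sim>b \<otimes> a \<otimes> z \<preceq> \<sim>\<one>\<close>. The right side is the
  implication that \<open>direct_reduct\<close> uses.\<close>

lemma imp_conv_neg:
  assumes "a \<in> carrier A" "b \<in> carrier A"
  shows "a \<leadsto> b = \<sim>(\<sim>b \<otimes> a)"
proof (rule eq_by_lower_bounds)
  fix z assume z: "z \<in> carrier A"
  have "z \<preceq> a \<leadsto> b \<longleftrightarrow> a \<otimes> z \<preceq> \<sim>\<sim>b" using assms z by (simp add: residuation inv_neg_inv_neg)
  also have "\<dots> \<longleftrightarrow> \<sim>b \<otimes> (a \<otimes> z) \<preceq> \<sim>\<one>" using assms z by (intro le_neg_iff) (auto simp: closed)
  also have "\<dots> \<longleftrightarrow> z \<preceq> \<sim>(\<sim>b \<otimes> a)"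
    using assms z le_neg_iff[of "\<sim>b \<otimes> a" z] by (simp add: closed m_assoc)
  finally show "z \<preceq> a \<leadsto> b \<longleftrightarrow> z \<preceq> \<sim>(\<sim>b \<otimes> a)" .
qed (use assms in \<open>auto simp: closed\<close>)

lemma imp_neg_neg: "\<lbrakk>a \<in> carrier A; b \<in> carrier A\<rbrakk> \<Longrightarrow> \<sim>b \<leadsto> \<sim>a = a \<leadsto> b"
  using contraposition[of a "\<sim>b"] by (simp add: inv_neg_inv_neg closed)

lemma neg_antimono: "\<lbrakk>a \<in> carrier A; b \<in> carrier A; a \<preceq> b\<rbrakk> \<Longrightarrow> \<sim>b \<preceq> \<sim>a"
  by (metis closed(6) imp_neg_neg one_le_imp_iff)

lemma mult_neg_le: "a \<in> carrier A \<Longrightarrow> a \<otimes> \<sim>a \<preceq> \<sim>\<one>"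
  using le_neg_iff[of a "\<sim>a"] by (simp add: closed le_refl)

lemma neg_one_le_one: "\<sim>\<one> \<preceq> \<one>"
proof -
  have "\<sim>\<one> \<otimes> \<sim>\<one> \<preceq> \<sim>\<one>" by (simp add: idempotent closed le_refl)
  hence "\<sim>\<one> \<preceq> \<sim>\<sim>\<one>" using le_neg_iff[of "\<sim>\<one>" "\<sim>\<one>"] by (simp add: closed)
  thus ?thesis by (simp add: inv_neg_inv_neg)
qed

text \<open>By idempotence the meet is its own square, and the square is below the product by
  monotonicity.\<close>

lemma meet_le_mult:
  assumes "a \<in> carrier A" "b \<in> carrier A"
  shows "a \<curlywedge> b \<preceq> a \<otimes> b"
proof -
  have "(a \<curlywedge> b) \<otimes> (a \<curlywedge> b) \<preceq> a \<otimes> b"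
    using assms by (intro mult_mono) (auto simp: closed meet_le1 meet_le2)
  thus ?thesis using assms by (simp add: idempotent closed)
qed

text \<open>The negation of \<open>a \<curlyvee> \<sim>a\<close> is below
  \<open>a \<curlywedge> \<sim>a\<close>, hence below \<open>a \<otimes> \<sim>a\<close> and so
  below \<open>\<sim>\<one>\<close>; negating once more gives the claim.\<close>

lemma excluded_middle:
  assumes "a \<in> carrier A"
  shows "\<one> \<preceq> a \<curlyvee> \<sim>a"
proof -
  let ?u = "a \<curlyvee> \<sim>a"
  have u: "?u \<in> carrier A" using assms by (simp add: closed)
  have "\<sim>?u \<preceq> \<sim>a" "\<sim>?u \<preceq> \<sim>\<sim>a"
    using assms by (auto intro: neg_antimono le_join1 le_join2 closed)
  hence "\<sim>?u \<preceq> a \<curlywedge> \<sim>a" using assms by (simp add: inv_neg_inv_neg le_meetI closed)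
  moreover have "a \<curlywedge> \<sim>a \<preceq> \<sim>\<one>"
    by (rule le_trans[OF _ _ _ meet_le_mult mult_neg_le]) (use assms in \<open>auto simp: closed\<close>)
  ultimately have "\<sim>?u \<preceq> \<sim>\<one>"
    by (rule le_trans[rotated 3]) (use assms in \<open>auto simp: closed\<close>)
  hence "\<sim>\<sim>\<one> \<preceq> \<sim>\<sim>?u" using u by (blast intro: neg_antimono closed)
  thus ?thesis using u by (simp add: inv_neg_inv_neg closed)
qed

text \<open>A cut rule from distributivity: the part of \<open>e\<close> under \<open>u\<close>
  splits along \<open>y \<curlyvee> v\<close> into a piece below \<open>y\<close> and a piece below
  \<open>u \<curlywedge> v\<close>, which \<open>x\<close> absorbs.\<close>

lemma join_cancel:
  assumes "x \<in> carrier A" "y \<in> carrier A" "u \<in> carrier A" "v \<in> carrier A" "e \<in> carrier A"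
    and "e \<preceq> x \<curlyvee> u" "e \<preceq> y \<curlyvee> v" "u \<curlywedge> v \<preceq> x"
  shows "e \<preceq> x \<curlyvee> y"
proof -
  let ?w = "x \<curlyvee> y"
  have w: "?w \<in> carrier A" using assms by (simp add: closed)
  have xw: "x \<preceq> ?w" "y \<preceq> ?w" using assms by (auto intro: le_join1 le_join2)
  have eu: "e \<curlywedge> u \<preceq> ?w"
  proof -
    have "e \<curlywedge> u \<preceq> u \<curlywedge> (y \<curlyvee> v)"
      using assms by (intro le_meetI meet_le_coboundedI1 meet_le2) (auto intro: closed)
    also have "u \<curlywedge> (y \<curlyvee> v) = (u \<curlywedge> y) \<curlyvee> (u \<curlywedge> v)" using assms by (simp add: meet_join_distrib)
    finally have *: "e \<curlywedge> u \<preceq> (u \<curlywedge> y) \<curlyvee> (u \<curlywedge> v)" .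
    have "u \<curlywedge> y \<preceq> ?w" "u \<curlywedge> v \<preceq> ?w"
      using assms w xw by (auto intro: meet_le_coboundedI2 le_trans[of "u \<curlywedge> v" x] closed)
    hence "(u \<curlywedge> y) \<curlyvee> (u \<curlywedge> v) \<preceq> ?w" using assms w by (auto intro: join_leI closed)
    with * show ?thesis by (rule le_trans[rotated 3]) (use assms in \<open>auto simp: closed\<close>)
  qed
  have "e = e \<curlywedge> (x \<curlyvee> u)" using assms by simp
  also have "\<dots> = (e \<curlywedge> x) \<curlyvee> (e \<curlywedge> u)" using assms by (simp add: meet_join_distrib)
  finally have e: "e = (e \<curlywedge> x) \<curlyvee> (e \<curlywedge> u)" .
  have "e \<curlywedge> x \<preceq> ?w" using assms w xw by (auto intro: meet_le_coboundedI2)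
  hence "(e \<curlywedge> x) \<curlyvee> (e \<curlywedge> u) \<preceq> ?w" using eu assms w by (auto intro: join_leI closed)
  with e show ?thesis by simp
qed

text \<open>\<open>?u\<close> and \<open>?v\<close> are the negations of the two implications, so
  excluded middle and the cut rule leave only \<open>?u \<curlywedge> ?v\<close> to bound.
  Multiplied by \<open>?u\<close> it is below \<open>?u \<otimes> ?v\<close>, which regroups to
  \<open>(a \<otimes> \<sim>a) \<otimes> (b \<otimes> \<sim>b)\<close> and is therefore below
  \<open>\<sim>\<one>\<close>. So it is below \<open>\<sim>?u\<close>, which is
  \<open>a \<leadsto> b\<close>.\<close>

lemma prelinearity:
  assumes a: "a \<in> carrier A" and b: "b \<in> carrier A"
  shows "\<one> \<preceq> (a \<leadsto> b) \<curlyvee> (b \<leadsto> a)"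
proof -
  let ?u = "\<sim>b \<otimes> a" and ?v = "\<sim>a \<otimes> b"
  have uv: "?u \<in> carrier A" "?v \<in> carrier A" using a b by (auto simp: closed)
  have em: "\<one> \<preceq> (a \<leadsto> b) \<curlyvee> ?u" "\<one> \<preceq> (b \<leadsto> a) \<curlyvee> ?v"
    using excluded_middle[OF uv(1)] excluded_middle[OF uv(2)] a b
    by (simp_all add: imp_conv_neg join_comm closed)
  have low: "?u \<curlywedge> ?v \<preceq> a \<leadsto> b"
  proof -
    let ?p = "?u \<curlywedge> ?v"
    have "?u \<otimes> ?p \<preceq> ?u \<otimes> ?v" using uv by (intro mult_mono_right) (auto simp: closed meet_le2)
    also have "?u \<otimes> ?v = (a \<otimes> \<sim>a) \<otimes> (b \<otimes> \<sim>b)"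
      using a b by (simp add: m_ac closed)
    finally have 1: "?u \<otimes> ?p \<preceq> (a \<otimes> \<sim>a) \<otimes> (b \<otimes> \<sim>b)" .
    have "(a \<otimes> \<sim>a) \<otimes> (b \<otimes> \<sim>b) \<preceq> \<sim>\<one> \<otimes> \<sim>\<one>"
      using a b by (intro mult_mono) (auto simp: closed mult_neg_le)
    hence 2: "(a \<otimes> \<sim>a) \<otimes> (b \<otimes> \<sim>b) \<preceq> \<sim>\<one>" by (simp add: idempotent closed)
    have "?u \<otimes> ?p \<preceq> \<sim>\<one>"
      by (rule le_trans[OF _ _ _ 1 2]) (use a b in \<open>auto simp: closed\<close>)
    hence "?p \<preceq> \<sim>?u" 
      by (rule iffD2[OF le_neg_iff, rotated 2]) (use uv in \<open>simp_all add: closed\<close>)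
    thus ?thesis using a b by (simp add: imp_conv_neg)
  qed
  show ?thesis
    by (rule join_cancel[OF _ _ uv _ em low]) (use a b in \<open>simp_all add: closed\<close>)
qed

end

section \<open>Relational representations\<close>

text \<open>The order on the points is \<open>h \<one>\<close> itself. The last two assumptions are
  pointwise forms of the two concrete negations, both of which have to represent the single negation
  of \<open>A\<close>.\<close>

locale sugihara_relational_rep = sugihara_monoid A for A (structure) +
  fixes X :: "'x set" and E :: "'x rel" and \<alpha> :: "'x \<Rightarrow> 'x" and h :: "'a \<Rightarrow> 'x rel"
  assumes equiv: "equiv X E"
    and bij: "bij_betw \<alpha> X X"
    and orbit: "x \<in> X \<Longrightarrow> (x, \<alpha> x) \<in> E"
    and rep_sub: "a \<in> carrier A \<Longrightarrow> h a \<subseteq> E"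
    and rep_refl: "x \<in> X \<Longrightarrow> (x, x) \<in> h \<one>"
    and rep_antisym: "antisym (h \<one>)"
    and rep_mult: "\<lbrakk>a \<in> carrier A; b \<in> carrier A\<rbrakk> \<Longrightarrow> h (a \<otimes> b) = h a O h b"
    and rep_meet: "\<lbrakk>a \<in> carrier A; b \<in> carrier A\<rbrakk> \<Longrightarrow> h (a \<curlywedge> b) = h a \<inter> h b"
    and rep_join: "\<lbrakk>a \<in> carrier A; b \<in> carrier A\<rbrakk> \<Longrightarrow> h (a \<curlyvee> b) = h a \<union> h b"
    and rep_minus: "\<lbrakk>a \<in> carrier A; (x, y) \<in> E\<rbrakk> \<Longrightarrow> (x, y) \<in> h (\<sim>a) \<longleftrightarrow> (y, \<alpha> x) \<notin> h a"
    and rep_tilde: "\<lbrakk>a \<in> carrier A; (x, y) \<in> E\<rbrakk> \<Longrightarrow> (x, \<alpha> y) \<in> h (\<sim>a) \<longleftrightarrow> (y, x) \<notin> h a"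

text \<open>With a commutative product the left and right negations agree, so both are taken to be
  the given one.\<close>

definition cyclic_dinfl :: "('a, 'm) sugihara_sig_scheme \<Rightarrow> 'a dinfl_sig" where
  "cyclic_dinfl A =
     \<lparr> carrier = carrier A, mult = mult A, one = one A, lmeet = lmeet A, ljoin = ljoin A,
       tilde = inv_neg A, minus_neg = inv_neg A \<rparr>"

context sugihara_monoid
begin

lemma dinfl_algebra_cyclic_dinfl: "dinfl_algebra (cyclic_dinfl A)"
proof -
  \<comment> \<open>By commutativity the right residual is the left one with its arguments
    swapped.\<close>
  have "distributive_residuated_lattice (cyclic_dinfl A) (imp A) (\<lambda>c b. imp A b c)"
    by unfold_locales
      (simp_all add: cyclic_dinfl_def closed m_assoc meet_assoc join_assoc meet_absorb
        join_absorb meet_join_distrib residuation[symmetric], simp_all add: m_comm meet_comm join_comm)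
  thus ?thesis
    unfolding dinfl_algebra_def
    by (intro conjI exI[of _ "imp A"] exI[of _ "\<lambda>c b. imp A b c"] bexI[of _ "\<sim>\<one>"])
      (simp_all add: cyclic_dinfl_def closed inv_neg_inv_neg imp_neg_one)
qed

lemma sugihara_iso_cyclic_dinfl: "id \<in> sugihara_iso A (direct_reduct (cyclic_dinfl A))"
  by (auto simp: sugihara_iso_def lat_monoid_iso_def iso_def hom_def direct_reduct_def
      cyclic_dinfl_def closed imp_conv_neg)

end

section \<open>From a relational representation to a subalgebra of a concrete algebra\<close>

context sugihara_relational_rep
begin

lemma E_carrier: "(x, y) \<in> E \<Longrightarrow> x \<in> X \<and> y \<in> X"
  and E_refl: "x \<in> X \<Longrightarrow> (x, x) \<in> E"
  and E_sym: "(x, y) \<in> E \<Longrightarrow> (y, x) \<in> E"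
  and E_trans: "\<lbrakk>(x, y) \<in> E; (y, z) \<in> E\<rbrakk> \<Longrightarrow> (x, z) \<in> E"
  using equiv unfolding equiv_def refl_on_def sym_def trans_def by blast+

lemma alpha_in: "x \<in> X \<Longrightarrow> \<alpha> x \<in> X"
  using bij bij_betwE by blast

lemma E_alpha:
  assumes "x \<in> X" "y \<in> X"
  shows "(x, \<alpha> y) \<in> E \<longleftrightarrow> (x, y) \<in> E" "(\<alpha> x, y) \<in> E \<longleftrightarrow> (x, y) \<in> E"
  using assms orbit E_sym E_trans by blast+

text \<open>Transitivity of the order is \<open>\<one> \<otimes> \<one> = \<one>\<close>. That
  \<alpha> is an automorphism comes from evaluating \<open>\<sim>\<one>\<close> at
  \<open>(y, \<alpha> x)\<close> in two ways: the tilde condition turns it into the failure of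
  \<open>(x, y)\<close>, the minus condition into the failure of
  \<open>(\<alpha> x, \<alpha> y)\<close>.\<close>

lemma dinfl_frame_rep: "dinfl_frame X (h \<one>) E \<alpha>"
proof -
  have sub: "h \<one> \<subseteq> E" using rep_sub by simp
  have "trans (h \<one>)" using rep_mult[of \<one> \<one>] by (auto simp: trans_def)
  hence "partial_order_on X (h \<one>)"
    using sub E_carrier rep_refl rep_antisym
    by (auto simp: partial_order_on_def preorder_on_def refl_on_def)
  moreover have "(x, y) \<in> h \<one> \<longleftrightarrow> (\<alpha> x, \<alpha> y) \<in> h \<one>" if xy: "x \<in> X" "y \<in> X" for x y
  proof (cases "(x, y) \<in> E")
    case True
    have "(y, \<alpha> x) \<in> E" using True xy E_sym E_alpha by blast
    thus ?thesis
      using rep_tilde[of \<one> y x] rep_minus[of \<one> y "\<alpha> x"] True E_sym by auto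
  next
    case False
    hence "(\<alpha> x, \<alpha> y) \<notin> E" using xy E_alpha alpha_in by blast
    with False sub show ?thesis by blast
  qed
  ultimately show ?thesis
    unfolding dinfl_frame_def order_automorphism_def graph_on_def
    using equiv bij sub orbit by auto
qed

text \<open>Being an upset means absorbing the order on both sides, which is the unit law for
  \<open>\<otimes>\<close>.\<close>

lemma rep_upset: "a \<in> carrier A \<Longrightarrow> h a \<in> rel_upsets (h \<one>) E"
  using rep_mult[of a \<one>] rep_mult[of \<one> a] rep_sub[of a] unfolding rel_upsets_def by auto

lemma concrete_tilde:
  assumes a: "a \<in> carrier A"
  shows "(E - h a)\<inverse> O graph_on X \<alpha> = h (\<sim>a)"
proof (intro equalityI subrelI)
  fix x w assume "(x, w) \<in> (E - h a)\<inverse> O graph_on X \<alpha>"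
  then obtain y where "w = \<alpha> y" "(y, x) \<in> E" "(y, x) \<notin> h a" unfolding graph_on_def by blast
  thus "(x, w) \<in> h (\<sim>a)" using rep_tilde[OF a] E_sym by blast
next
  fix x w assume xw: "(x, w) \<in> h (\<sim>a)"
  hence E: "(x, w) \<in> E" using rep_sub a inv_neg_closed by blast
  hence "x \<in> X" "w \<in> X" using E_carrier by blast+
  then obtain y where y: "y \<in> X" "w = \<alpha> y" using bij by (auto simp: bij_betw_def)
  have "(x, y) \<in> E" using E y \<open>x \<in> X\<close> E_alpha by blast
  moreover have "(y, x) \<notin> h a" using rep_tilde[OF a calculation] xw y by blast
  ultimately show "(x, w) \<in> (E - h a)\<inverse> O graph_on X \<alpha>" using y E_sym unfolding graph_on_def by blast
qed

lemma concrete_minus: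
  assumes a: "a \<in> carrier A"
  shows "graph_on X \<alpha> O (E - h a)\<inverse> = h (\<sim>a)"
proof (intro equalityI subrelI)
  fix x y assume "(x, y) \<in> graph_on X \<alpha> O (E - h a)\<inverse>"
  hence *: "x \<in> X" "(y, \<alpha> x) \<in> E" "(y, \<alpha> x) \<notin> h a" unfolding graph_on_def by auto
  hence "(x, y) \<in> E" using E_carrier E_sym E_alpha by blast
  thus "(x, y) \<in> h (\<sim>a)" using rep_minus[OF a] * by blast
next
  fix x y assume xy: "(x, y) \<in> h (\<sim>a)"
  hence E: "(x, y) \<in> E" using rep_sub a inv_neg_closed by blast
  hence "x \<in> X" "(y, \<alpha> x) \<in> E" using E_carrier E_sym E_alpha by blast+
  thus "(x, y) \<in> graph_on X \<alpha> O (E - h a)\<inverse>"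
    using rep_minus[OF a E] xy unfolding graph_on_def by blast
qed

lemma representable_over_cyclic_dinfl:
  assumes inj: "inj_on h (carrier A)"
  shows "representable_over TYPE('x) (cyclic_dinfl A)"
proof -
  let ?C = "concrete_dinfl X (h \<one>) E \<alpha>" and ?S = "h ` carrier A"
  have "dinfl_subalgebra ?S ?C"
    unfolding dinfl_subalgebra_def concrete_dinfl_def
    by (auto simp: rep_upset concrete_tilde concrete_minus closed rep_mult[symmetric]
        rep_meet[symmetric] rep_join[symmetric])
  moreover have "h \<in> dinfl_iso (cyclic_dinfl A) (?C\<lparr>carrier := ?S\<rparr>)"
    using inj by (simp add: dinfl_iso_def lat_monoid_iso_def iso_def hom_def concrete_dinfl_def
        cyclic_dinfl_def concrete_tilde concrete_minus rep_mult rep_meet rep_join bij_betw_def)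
  ultimately show ?thesis
    unfolding representable_over_def using dinfl_algebra_cyclic_dinfl dinfl_frame_rep by blast
qed

end

text \<open>Disjoint union of a family of representations. The bijection \<open>d\<close> sends each
  point to its index and its position in that summand, so the union can live on any type with enough
  elements. All relations stay within summands, so each condition is inherited from the summand of
  the first point.\<close>

lemma (in sugihara_monoid) sugihara_relational_rep_sum:
  fixes d :: "'p \<Rightarrow> 'j \<times> 'x"
  assumes rep: "\<And>j. j \<in> J \<Longrightarrow> sugihara_relational_rep A (X j) (E j) (\<alpha> j) (h j)"
    and d: "bij_betw d P (Sigma J X)"
  shows "sugihara_relational_rep A P
    {(p, q) \<in> P \<times> P. fst (d p) = fst (d q) \<and> (snd (d p), snd (d q)) \<in> E (fst (d p))}
    (\<lambda>p. inv_into P d (fst (d p), \<alpha> (fst (d p)) (snd (d p))))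
    (\<lambda>a. {(p, q) \<in> P \<times> P. fst (d p) = fst (d q) \<and> (snd (d p), snd (d q)) \<in> h (fst (d p)) a})"
    (is "sugihara_relational_rep A P ?E ?\<alpha> ?h")
proof -
  have dP: "fst (d p) \<in> J" "snd (d p) \<in> X (fst (d p))" if "p \<in> P" for p
    using bij_betwE[OF d] that by (auto simp: mem_Sigma_iff split_beta)
  have surj: "\<exists>p \<in> P. d p = (j, x)" if "j \<in> J" "x \<in> X j" for j x
    using d that by (force simp: bij_betw_def image_iff set_eq_iff)
  have inj: "p = q" if "p \<in> P" "q \<in> P" "fst (d p) = fst (d q)" "snd (d p) = snd (d q)" for p q
    using d that prod_eqI[of "d p" "d q"] by (meson bij_betw_def inj_onD)
  have \<alpha>: "?\<alpha> p \<in> P \<and> d (?\<alpha> p) = (fst (d p), \<alpha> (fst (d p)) (snd (d p)))" if p: "p \<in> P" for p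
  proof -
    interpret sugihara_relational_rep A "X (fst (d p))" "E (fst (d p))" "\<alpha> (fst (d p))" "h (fst (d p))"
      using rep dP p by blast
    have "(fst (d p), \<alpha> (fst (d p)) (snd (d p))) \<in> d ` P"
      using d dP[OF p] alpha_in by (auto simp: bij_betw_def)
    thus ?thesis by (simp add: inv_into_into f_inv_into_f)
  qed
  note R = rep[OF dP(1)]
  show ?thesis
  proof (unfold_locales)
    show "equiv P ?E"
    proof (rule equivI)
      show "refl_on P ?E"
        using sugihara_relational_rep.E_refl[OF R] dP by (auto simp: refl_on_def)
      show "sym ?E" using sugihara_relational_rep.E_sym[OF R] by (auto simp: sym_def)
      show "trans ?E"
      proof (rule transI)
        fix p q r assume pq: "(p, q) \<in> ?E" and qr: "(q, r) \<in> ?E"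
        hence p: "p \<in> P" by blast
        show "(p, r) \<in> ?E"
          using sugihara_relational_rep.E_trans[OF R[OF p], of "snd (d p)" "snd (d q)" "snd (d r)"]
            pq qr by auto
      qed
    qed auto
    show "bij_betw ?\<alpha> P P"
    proof (rule bij_betwI')
      show "?\<alpha> p = ?\<alpha> q \<longleftrightarrow> p = q" if "p \<in> P" "q \<in> P" for p q
      proof
        assume eq: "?\<alpha> p = ?\<alpha> q"
        have "(fst (d p), \<alpha> (fst (d p)) (snd (d p))) = d (?\<alpha> p)"
          by (rule conjunct2[OF \<alpha>[OF that(1)], symmetric])
        also have "\<dots> = d (?\<alpha> q)" by (simp only: eq)
        also have "\<dots> = (fst (d q), \<alpha> (fst (d q)) (snd (d q)))"
          by (rule conjunct2[OF \<alpha>[OF that(2)]])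
        finally have f: "fst (d p) = fst (d q)"
          and "\<alpha> (fst (d p)) (snd (d p)) = \<alpha> (fst (d q)) (snd (d q))"
          unfolding prod.inject by blast+
        moreover have "inj_on (\<alpha> (fst (d p))) (X (fst (d p)))"
          using sugihara_relational_rep.bij[OF R] that by (auto simp: bij_betw_def)
        ultimately have "snd (d p) = snd (d q)" using dP that by (metis inj_onD)
        with f show "p = q" using inj that by blast
      qed simp
      show "?\<alpha> p \<in> P" if "p \<in> P" for p using \<alpha> that by blast
      show "\<exists>p \<in> P. q = ?\<alpha> p" if q: "q \<in> P" for q
      proof -
        obtain x where x: "x \<in> X (fst (d q))" "snd (d q) = \<alpha> (fst (d q)) x"
          using sugihara_relational_rep.bij[OF R] dP q unfolding bij_betw_def by blast
        then obtain p where p: "p \<in> P" "d p = (fst (d q), x)" using surj dP q by blast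
        have "q = ?\<alpha> p" by (rule inj) (use \<alpha>[OF p(1)] p x q in auto)
        thus ?thesis using p by blast
      qed
    qed
    show "(p, ?\<alpha> p) \<in> ?E" if "p \<in> P" for p
      using \<alpha>[OF that] sugihara_relational_rep.orbit[OF R] dP that by auto
    show "?h a \<subseteq> ?E" if "a \<in> carrier A" for a
      using sugihara_relational_rep.rep_sub[OF R] that by blast
    show "(p, p) \<in> ?h \<one>" if "p \<in> P" for p
      using sugihara_relational_rep.rep_refl[OF R] dP that by auto
    show "antisym (?h \<one>)"
    proof (rule antisymI)
      fix p q assume pq: "(p, q) \<in> ?h \<one>" "(q, p) \<in> ?h \<one>"
      hence "antisym (h (fst (d p)) \<one>)" using sugihara_relational_rep.rep_antisym[OF R] by blast
      with pq have "snd (d p) = snd (d q)" by (auto dest: antisymD)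
      with pq inj show "p = q" by blast
    qed
    fix a assume a: "a \<in> carrier A"
    show "?h (a \<otimes> b) = ?h a O ?h b" if b: "b \<in> carrier A" for b
    proof (intro equalityI subrelI)
      fix p r assume pr: "(p, r) \<in> ?h (a \<otimes> b)"
      hence p: "p \<in> P" by blast
      interpret sugihara_relational_rep A "X (fst (d p))" "E (fst (d p))" "\<alpha> (fst (d p))" "h (fst (d p))"
        using R p .
      obtain y where y: "(snd (d p), y) \<in> h (fst (d p)) a" "(y, snd (d r)) \<in> h (fst (d p)) b"
        using pr rep_mult a b by auto
      \<comment> \<open>The midpoint found in the summand must be named by a point of
        \<open>P\<close>.\<close>
      hence "y \<in> X (fst (d p))" using rep_sub[OF a] E_carrier by blast
      then obtain q where "q \<in> P" "d q = (fst (d p), y)" using surj dP p by blast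
      with y pr have "(p, q) \<in> ?h a" "(q, r) \<in> ?h b" by auto
      thus "(p, r) \<in> ?h a O ?h b" by blast
    next
      fix p r assume "(p, r) \<in> ?h a O ?h b"
      thus "(p, r) \<in> ?h (a \<otimes> b)" using sugihara_relational_rep.rep_mult[OF R a b] by auto
    qed
    show "?h (a \<curlywedge> b) = ?h a \<inter> ?h b" if b: "b \<in> carrier A" for b
      using sugihara_relational_rep.rep_meet[OF R a b] by auto
    show "?h (a \<curlyvee> b) = ?h a \<union> ?h b" if b: "b \<in> carrier A" for b
      using sugihara_relational_rep.rep_join[OF R a b] by auto
    show "(p, q) \<in> ?h (\<sim>a) \<longleftrightarrow> (q, ?\<alpha> p) \<notin> ?h a" if pq: "(p, q) \<in> ?E" for p q
      using sugihara_relational_rep.rep_minus[OF R a, of p "snd (d p)" "snd (d q)"] pq \<alpha>[of p] by auto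
    show "(p, ?\<alpha> q) \<in> ?h (\<sim>a) \<longleftrightarrow> (q, p) \<notin> ?h a" if pq: "(p, q) \<in> ?E" for p q
      using sugihara_relational_rep.rep_tilde[OF R a, of p "snd (d p)" "snd (d q)"] pq \<alpha>[of q] by auto
  qed
qed

section \<open>Chains from prime filters\<close>

locale sugihara_chain = sugihara_monoid A for A (structure) +
  fixes F :: "'a set"
  assumes prime: "prime_filter A F"
begin

declare closed [simp]

definition ple :: "'a \<Rightarrow> 'a \<Rightarrow> bool" (infix \<open>\<trianglelefteq>\<close> 50) where
  "a \<trianglelefteq> b \<longleftrightarrow> a \<leadsto> b \<in> F"

lemma filter_up: "\<lbrakk>x \<in> F; y \<in> carrier A; x \<preceq> y\<rbrakk> \<Longrightarrow> y \<in> F"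
  and filter_one: "\<one> \<in> F"
  and filter_carrier: "x \<in> F \<Longrightarrow> x \<in> carrier A"
  and filter_meet: "\<lbrakk>x \<in> F; y \<in> F\<rbrakk> \<Longrightarrow> x \<curlywedge> y \<in> F"
  and filter_join: "\<lbrakk>x \<in> carrier A; y \<in> carrier A; x \<curlyvee> y \<in> F\<rbrakk> \<Longrightarrow> x \<in> F \<or> y \<in> F"
  using prime unfolding prime_filter_def by blast+

text \<open>The product dominates the meet, so a lattice filter is closed under
  multiplication.\<close>

lemma filter_mult: "\<lbrakk>x \<in> F; y \<in> F\<rbrakk> \<Longrightarrow> x \<otimes> y \<in> F"
  by (rule filter_up[OF filter_meet _ meet_le_mult]) (simp_all add: filter_carrier)

lemma ple_if_le: "\<lbrakk>a \<in> carrier A; b \<in> carrier A; a \<preceq> b\<rbrakk> \<Longrightarrow> a \<trianglelefteq> b"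
  unfolding ple_def by (rule filter_up[OF filter_one]) (simp_all add: one_le_imp_iff)

lemma ple_refl: "a \<in> carrier A \<Longrightarrow> a \<trianglelefteq> a"
  by (simp add: ple_if_le le_refl)

lemma ple_mult:
  assumes "a \<in> carrier A" "b \<in> carrier A" "c \<in> carrier A" "a \<trianglelefteq> b"
  shows "c \<otimes> a \<trianglelefteq> c \<otimes> b"
proof -
  have "c \<otimes> (a \<otimes> (a \<leadsto> b)) \<preceq> c \<otimes> b" using assms by (intro mult_mono_right mult_imp_le) auto
  hence "(c \<otimes> a) \<otimes> (a \<leadsto> b) \<preceq> c \<otimes> b" using assms by (simp add: m_assoc)
  hence "(a \<leadsto> b) \<preceq> c \<otimes> a \<leadsto> c \<otimes> b" using assms by (blast intro: iffD1[OF residuation] closed)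
  with \<open>a \<trianglelefteq> b\<close> show ?thesis unfolding ple_def using assms by (blast intro: filter_up closed)
qed

lemma ple_trans:
  assumes "a \<in> carrier A" "b \<in> carrier A" "c \<in> carrier A" "a \<trianglelefteq> b" "b \<trianglelefteq> c"
  shows "a \<trianglelefteq> c"
proof -
  have 1: "(b \<leadsto> c) \<otimes> (a \<otimes> (a \<leadsto> b)) \<preceq> (b \<leadsto> c) \<otimes> b"
    using assms by (intro mult_mono_right mult_imp_le) auto
  have 2: "(b \<leadsto> c) \<otimes> b \<preceq> c" using assms mult_imp_le[of b c] by (simp add: m_comm)
  have "(b \<leadsto> c) \<otimes> (a \<otimes> (a \<leadsto> b)) \<preceq> c"
    by (rule le_trans[OF _ _ _ 1 2]) (use assms in simp_all)
  hence "a \<otimes> ((a \<leadsto> b) \<otimes> (b \<leadsto> c)) \<preceq> c" using assms by (simp add: m_ac)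
  hence "(a \<leadsto> b) \<otimes> (b \<leadsto> c) \<preceq> a \<leadsto> c" using assms by (blast intro: iffD1[OF residuation] closed)
  thus ?thesis using assms unfolding ple_def by (blast intro: filter_mult filter_up closed)
qed

text \<open>Primeness splits the join provided by prelinearity.\<close>

lemma ple_total: "\<lbrakk>a \<in> carrier A; b \<in> carrier A\<rbrakk> \<Longrightarrow> a \<trianglelefteq> b \<or> b \<trianglelefteq> a"
  unfolding ple_def
  by (rule filter_join) (simp_all add: filter_up[OF filter_one] prelinearity)

lemma one_ple_iff: "a \<in> carrier A \<Longrightarrow> \<one> \<trianglelefteq> a \<longleftrightarrow> a \<in> F"
  unfolding ple_def by (simp add: one_imp)

lemma neg_ple_neg_iff: "\<lbrakk>a \<in> carrier A; b \<in> carrier A\<rbrakk> \<Longrightarrow> \<sim>b \<trianglelefteq> \<sim>a \<longleftrightarrow> a \<trianglelefteq> b"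
  unfolding ple_def by (simp add: imp_neg_neg)

lemma one_ple_or_neg: "a \<in> carrier A \<Longrightarrow> \<one> \<trianglelefteq> a \<or> \<one> \<trianglelefteq> \<sim>a"
  using filter_join[of a "\<sim>a"] filter_up[OF filter_one _ excluded_middle]
  by (simp add: one_ple_iff)

text \<open>Residuating suitable multiples by a member of \<open>F\<close> makes meet and join the
  minimum and maximum of the quotient chain.\<close>

lemma ple_meet_and_join:
  assumes a: "a \<in> carrier A" and b: "b \<in> carrier A" and ab: "a \<trianglelefteq> b"
  shows "a \<trianglelefteq> a \<curlywedge> b" "a \<curlyvee> b \<trianglelefteq> b"
proof -
  \<comment> \<open>The cap at \<open>\<one>\<close> makes multiplication by \<open>p\<close>
    decreasing, so \<open>a \<otimes> p\<close> lies below both \<open>a\<close> and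
    \<open>b\<close>.\<close>
  define p where "p = (a \<leadsto> b) \<curlywedge> \<one>"
  have pF: "p \<in> F" unfolding p_def using ab by (simp add: ple_def filter_meet filter_one)
  hence p: "p \<in> carrier A" by (rule filter_carrier)
  have p_le: "p \<preceq> a \<leadsto> b" "p \<preceq> \<one>"
    unfolding p_def using a b by (simp_all add: meet_le1 meet_le2)
  have ap: "a \<otimes> p \<preceq> b" using a b p p_le(1) by (intro iffD2[OF residuation])
  have xp: "x \<otimes> p \<preceq> x" if "x \<in> carrier A" for x
    using mult_mono_right[OF that p _ p_le(2)] that by simp
  have "a \<otimes> p \<preceq> a \<curlywedge> b" using a b p ap xp[OF a] by (intro le_meetI) auto
  hence "p \<preceq> a \<leadsto> a \<curlywedge> b" using a b p by (blast intro: iffD1[OF residuation] closed)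
  thus "a \<trianglelefteq> a \<curlywedge> b" unfolding ple_def by (rule filter_up[OF pF, rotated]) (use a b in simp)
  have "a \<preceq> p \<leadsto> b" "b \<preceq> p \<leadsto> b"
    using a b p ap xp[OF b] iffD1[OF residuation, of p _ b] by (simp_all add: m_comm)
  hence "a \<curlyvee> b \<preceq> p \<leadsto> b" using a b p by (intro join_leI) auto
  hence "p \<otimes> (a \<curlyvee> b) \<preceq> b" using a b p by (intro iffD2[OF residuation]) auto
  hence "(a \<curlyvee> b) \<otimes> p \<preceq> b" using a b p by (simp add: m_comm)
  hence "p \<preceq> a \<curlyvee> b \<leadsto> b" using a b p by (blast intro: iffD1[OF residuation] closed)
  thus "a \<curlyvee> b \<trianglelefteq> b" unfolding ple_def by (rule filter_up[OF pF, rotated]) (use a b in simp)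
qed

section \<open>Multiplication on the chain: the factor farther from the unit wins, ties of opposite
  sign going to the negative one\<close>

lemma mult_pos_pos:
  assumes "a \<in> carrier A" "b \<in> carrier A" "\<one> \<trianglelefteq> a" "a \<trianglelefteq> b"
  shows "a \<otimes> b \<trianglelefteq> b" "b \<trianglelefteq> a \<otimes> b"
  using ple_mult[of a b b] ple_mult[of \<one> a b] assms by (simp_all add: idempotent m_comm)

lemma mult_neg_neg:
  assumes "a \<in> carrier A" "b \<in> carrier A" "a \<trianglelefteq> b" "b \<trianglelefteq> \<one>"
  shows "a \<otimes> b \<trianglelefteq> a" "a \<trianglelefteq> a \<otimes> b"
  using ple_mult[of a b a] ple_mult[of b \<one> a] assms by (simp_all add: idempotent)

text \<open>Idempotence gives \<open>d \<otimes> d \<otimes> \<sim>d \<preceq> \<sim>\<one>\<close>,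
  so \<open>d \<otimes> \<sim>d\<close> is below \<open>\<sim>d\<close>; by monotonicity the smaller
  factor \<open>c\<close> cannot lift \<open>\<sim>d\<close> either.\<close>

lemma mult_pos_neg_dominated:
  assumes c: "c \<in> carrier A" and d: "d \<in> carrier A" and "\<one> \<trianglelefteq> c" "c \<trianglelefteq> d"
  shows "c \<otimes> \<sim>d \<trianglelefteq> \<sim>d" "\<sim>d \<trianglelefteq> c \<otimes> \<sim>d"
proof -
  have "d \<otimes> (d \<otimes> \<sim>d) \<preceq> \<sim>\<one>"
    using d mult_neg_le[OF d] by (simp add: m_assoc[symmetric] idempotent)
  hence "d \<otimes> \<sim>d \<preceq> \<sim>d" by (rule iffD2[OF le_neg_iff, rotated 2]) (use d in simp_all)
  hence "d \<otimes> \<sim>d \<trianglelefteq> \<sim>d" by (rule ple_if_le[rotated 2]) (use d in simp_all)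
  moreover have "c \<otimes> \<sim>d \<trianglelefteq> d \<otimes> \<sim>d" using ple_mult[of c d "\<sim>d"] assms by (simp add: m_comm)
  ultimately show "c \<otimes> \<sim>d \<trianglelefteq> \<sim>d" using ple_trans[of "c \<otimes> \<sim>d" "d \<otimes> \<sim>d" "\<sim>d"] c d by simp
  show "\<sim>d \<trianglelefteq> c \<otimes> \<sim>d" using ple_mult[of \<one> c "\<sim>d"] assms by (simp add: m_comm)
qed

lemma neg_ple_one: "\<lbrakk>a \<in> carrier A; \<one> \<trianglelefteq> a\<rbrakk> \<Longrightarrow> \<sim>a \<trianglelefteq> \<one>"
  using neg_ple_neg_iff[of \<one> a] ple_if_le[OF _ _ neg_one_le_one] ple_trans[of "\<sim>a" "\<sim>\<one>" \<one>] by simp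

text \<open>As \<open>c \<leadsto> d\<close> is not in \<open>F\<close>, its negation
  \<open>\<sim>d \<otimes> c\<close> is above the unit; multiplying by \<open>c\<close> and using
  idempotence gives the second inequality.\<close>

lemma mult_pos_neg_dominating:
  assumes c: "c \<in> carrier A" and d: "d \<in> carrier A" and "\<one> \<trianglelefteq> d" "\<not> c \<trianglelefteq> d"
  shows "c \<otimes> \<sim>d \<trianglelefteq> c" "c \<trianglelefteq> c \<otimes> \<sim>d"
proof -
  show "c \<otimes> \<sim>d \<trianglelefteq> c" using ple_mult[of "\<sim>d" \<one> c] neg_ple_one[of d] assms by simp
  have "c \<leadsto> d \<notin> F" using assms by (simp add: ple_def)
  hence "\<one> \<trianglelefteq> \<sim>(c \<leadsto> d)" using one_ple_or_neg[of "c \<leadsto> d"] c d by (simp add: one_ple_iff)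
  hence "\<one> \<trianglelefteq> \<sim>d \<otimes> c" using c d by (simp add: imp_conv_neg inv_neg_inv_neg)
  hence "c \<otimes> \<one> \<trianglelefteq> c \<otimes> (\<sim>d \<otimes> c)" by (rule ple_mult[rotated 3]) (use c d in simp_all)
  moreover have "c \<otimes> (\<sim>d \<otimes> c) = (c \<otimes> c) \<otimes> \<sim>d" using c d by (simp add: m_ac)
  ultimately show "c \<trianglelefteq> c \<otimes> \<sim>d" using c d by (simp add: idempotent)
qed

end

section \<open>Lexicographic representation of a chain\<close>

text \<open>\<open>I\<close> picks one representative from each class of the preorder, so that it is linearly ordered.\<close>

locale sugihara_chain_coords = sugihara_chain A F for A (structure) and F +
  fixes I :: "'a set" and u :: 'a
  assumes coords_carrier: "I \<subseteq> carrier A"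
    and coords_antisym: "\<lbrakk>i \<in> I; j \<in> I; i \<trianglelefteq> j; j \<trianglelefteq> i\<rbrakk> \<Longrightarrow> i = j"
    and coords_represent: "a \<in> carrier A \<Longrightarrow> \<exists>i \<in> I. i \<trianglelefteq> a \<and> a \<trianglelefteq> i"
    and unit_coord: "u \<in> I" "u \<trianglelefteq> \<one>" "\<one> \<trianglelefteq> u"
begin

text \<open>\<open>\<sim>\<one> \<preceq> \<one>\<close> always holds, so this makes the unit and
  its negation equivalent: the chain has a self-dual centre.\<close>

definition is_odd :: bool where
  "is_odd \<longleftrightarrow> \<one> \<trianglelefteq> \<sim>\<one>"

text \<open>Integrality at \<open>u\<close> in the odd case makes decrementing that coordinate a
  step to the immediate predecessor. In the other case fixing it at 0 leaves only dense
  coordinates.\<close>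

definition points :: "('a \<Rightarrow> rat) set" where
  "points = {x. finite {i. x i \<noteq> 0} \<and> {i. x i \<noteq> 0} \<subseteq> {i \<in> I. \<one> \<trianglelefteq> i} \<and>
     (if is_odd then x u \<in> \<int> else x u = 0)}"

definition shift :: "('a \<Rightarrow> rat) \<Rightarrow> 'a \<Rightarrow> rat" where
  "shift x = (if is_odd then x(u := x u - 1) else x)"

text \<open>By totality \<open>\<not> j \<trianglelefteq> i\<close> says that \<open>j\<close> is
  strictly above \<open>i\<close>, so \<open>i\<close> is the most significant coordinate of
  difference.\<close>

definition lex_at :: "('a \<Rightarrow> rat) \<Rightarrow> ('a \<Rightarrow> rat) \<Rightarrow> 'a \<Rightarrow> bool" where
  "lex_at x y i \<longleftrightarrow> i \<in> I \<and> x i < y i \<and> (\<forall>j \<in> I. \<not> j \<trianglelefteq> i \<longrightarrow> x j = y j)"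

text \<open>The second disjunct makes the unit coordinate visible at the unit level.\<close>

definition visible :: "'a \<Rightarrow> 'a \<Rightarrow> bool" where
  "visible c i \<longleftrightarrow> \<not> i \<trianglelefteq> c \<or> c \<trianglelefteq> \<one>"

text \<open>The strict lexicographic order at level \<open>c\<close>: for \<open>c\<close> strictly
  above the unit only the coordinates strictly above \<open>c\<close> count, otherwise all of them
  do.\<close>

definition slt :: "'a \<Rightarrow> ('a \<Rightarrow> rat) \<Rightarrow> ('a \<Rightarrow> rat) \<Rightarrow> bool" where
  "slt c x y \<longleftrightarrow> (\<exists>i. visible c i \<and> lex_at x y i)"

definition rel :: "'a \<Rightarrow> ('a \<Rightarrow> rat) rel" where
  "rel a = {(x, y) \<in> points \<times> points. if \<one> \<trianglelefteq> a then \<not> slt a y x else slt (\<sim>a) x y}"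

section \<open>Comparing points at a given level\<close>

lemma coordD: "i \<in> I \<Longrightarrow> i \<in> carrier A"
  using coords_carrier by blast

lemma ex_largest_coord:
  "\<lbrakk>finite B; B \<noteq> {}; B \<subseteq> I\<rbrakk> \<Longrightarrow> \<exists>m \<in> B. \<forall>j \<in> B. j \<trianglelefteq> m"
proof (induction B rule: finite_ne_induct)
  case (singleton i)
  thus ?case by (simp add: ple_refl coordD)
next
  case (insert i B)
  then obtain m where m: "m \<in> B" "\<forall>j \<in> B. j \<trianglelefteq> m" by blast
  have iC: "i \<in> carrier A" and mC: "m \<in> carrier A" using insert m coordD by auto
  show ?case
  proof (cases "i \<trianglelefteq> m")
    case True
    with m show ?thesis by blast
  next
    case False
    hence mi: "m \<trianglelefteq> i" using ple_total iC mC by blast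
    have "j \<trianglelefteq> i" if "j \<in> insert i B" for j
      using that m mi ple_trans[of j m i] iC mC insert coordD by (auto simp: ple_refl)
    thus ?thesis by blast
  qed
qed

lemma visible_up:
  "\<lbrakk>visible c i; c \<in> carrier A; i \<in> carrier A; j \<in> carrier A; i \<trianglelefteq> j\<rbrakk> \<Longrightarrow> visible c j"
  unfolding visible_def using ple_trans by blast

lemma visible_antimono:
  "\<lbrakk>visible d i; c \<in> carrier A; d \<in> carrier A; i \<in> carrier A; c \<trianglelefteq> d\<rbrakk> \<Longrightarrow> visible c i"
  unfolding visible_def using ple_trans one_closed by blast

lemma slt_antimono:
  "\<lbrakk>slt d x y; c \<in> carrier A; d \<in> carrier A; c \<trianglelefteq> d\<rbrakk> \<Longrightarrow> slt c x y"
  unfolding slt_def lex_at_def using visible_antimono coordD by blast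

lemma lex_at_asym:
  assumes "lex_at x y i" "lex_at y x j"
  shows False
proof -
  show False
  proof (cases "i = j")
    case False
    hence "\<not> i \<trianglelefteq> j \<or> \<not> j \<trianglelefteq> i" using assms coords_antisym by (auto simp: lex_at_def)
    thus ?thesis using assms unfolding lex_at_def by (metis less_irrefl)
  qed (use assms in \<open>auto simp: lex_at_def\<close>)
qed

lemma slt_asym: "slt c x y \<Longrightarrow> \<not> slt d y x"
  unfolding slt_def using lex_at_asym by blast

lemma slt_irrefl: "\<not> slt c x x"
  unfolding slt_def lex_at_def by simp

lemma points_differ:
  assumes "x \<in> points" "y \<in> points" "x i \<noteq> y i"
  shows "i \<in> I" "\<one> \<trianglelefteq> i"
  using assms unfolding points_def by (cases "x i = 0"; force)+

lemma finite_differ: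
  assumes "x \<in> points" "y \<in> points"
  shows "finite {i. x i \<noteq> y i}"
proof (rule finite_subset)
  show "{i. x i \<noteq> y i} \<subseteq> {i. x i \<noteq> 0} \<union> {i. y i \<noteq> 0}" by auto
qed (use assms in \<open>simp add: points_def\<close>)

text \<open>Let \<open>m\<close> be the largest coordinate at which \<open>y\<close> differs from
  \<open>x\<close> or from \<open>z\<close>. It is at or above the coordinate deciding
  \<open>x\<close> against \<open>z\<close>, so it is visible and \<open>x m \<le> z m\<close>.
  Hence one of the two steps through \<open>y\<close> increases there, while all three points agree
  above \<open>m\<close>.\<close>

lemma slt_cases:
  assumes "x \<in> points" "y \<in> points" "z \<in> points" "c \<in> carrier A" "slt c x z"
  shows "slt c x y \<or> slt c y z"
proof -
  obtain i where i: "visible c i" "lex_at x z i" using assms unfolding slt_def by blast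
  define B where "B = {j. x j \<noteq> y j} \<union> {j. y j \<noteq> z j}"
  have "i \<in> B" using i by (auto simp: B_def lex_at_def)
  moreover have "finite B" "B \<subseteq> I"
    using assms finite_differ points_differ unfolding B_def by auto
  ultimately obtain m where m: "m \<in> B" "m \<in> I" "\<forall>j \<in> B. j \<trianglelefteq> m" "i \<trianglelefteq> m"
    using ex_largest_coord[of B] by blast
  have agree: "x j = y j" "y j = z j" if "\<not> j \<trianglelefteq> m" for j
    using m that unfolding B_def by auto
  have vis: "visible c m" using i m assms visible_up coordD unfolding lex_at_def by blast
  have "x m = z m \<or> x m < z m"
  proof (cases "m \<trianglelefteq> i")
    case True
    hence "m = i" using m i coords_antisym unfolding lex_at_def by blast
    thus ?thesis using i by (simp add: lex_at_def)
  qed (use i m in \<open>simp add: lex_at_def\<close>)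
  hence "x m < y m \<or> y m < z m" using m(1) unfolding B_def by auto
  hence "lex_at x y m \<or> lex_at y z m" using m agree unfolding lex_at_def by auto
  thus ?thesis using vis unfolding slt_def by blast
qed

text \<open>Higher levels see fewer coordinates, so \<open>\<not> slt c\<close> implies
  \<open>\<not> slt d\<close>; negative transitivity at level \<open>d\<close> then leaves only the
  claimed comparison.\<close>

lemma slt_weak_trans:
  assumes "x \<in> points" "y \<in> points" "z \<in> points" "c \<in> carrier A" "d \<in> carrier A" "c \<trianglelefteq> d"
  shows "\<lbrakk>\<not> slt c y x; slt d y z\<rbrakk> \<Longrightarrow> slt d x z" "\<lbrakk>slt d x y; \<not> slt c z y\<rbrakk> \<Longrightarrow> slt d x z"
  using assms slt_cases[of y x z d] slt_cases[of x z y d] slt_antimono[of d _ _ c] by blast+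

lemma slt_total:
  assumes "x \<in> points" "y \<in> points" "x \<noteq> y"
  shows "slt \<one> x y \<or> slt \<one> y x"
proof -
  let ?B = "{i. x i \<noteq> y i}"
  have "?B \<noteq> {}" "?B \<subseteq> I" using assms points_differ by auto
  then obtain m where m: "m \<in> I" "x m \<noteq> y m" "\<forall>j \<in> ?B. j \<trianglelefteq> m"
    using ex_largest_coord[of ?B] finite_differ assms by blast
  have "lex_at x y m \<or> lex_at y x m"
    using m unfolding lex_at_def by (metis (mono_tags) linorder_neqE mem_Collect_eq)
  thus ?thesis unfolding slt_def visible_def by (auto simp: ple_refl)
qed

text \<open>The strict order at level \<open>c\<close> is only ever iterated when it is determined by the dense
  coordinates, that is, unless \<open>c\<close> is the unit of an odd chain.\<close>

definition dense_level :: "'a \<Rightarrow> bool" where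
  "dense_level c \<longleftrightarrow> \<not> is_odd \<or> \<not> c \<trianglelefteq> \<one>"

text \<open>The only coordinate in question is \<open>u\<close>. Points differ there only in an odd
  chain, and then a dense level lies strictly above the unit and hides \<open>u\<close>.\<close>

lemma visible_dense_coord:
  assumes "x \<in> points" "y \<in> points" "c \<in> carrier A" "\<one> \<trianglelefteq> c" "dense_level c"
    and "visible c i" "x i \<noteq> y i"
  shows "\<not> i \<trianglelefteq> \<one>"
proof
  assume i1: "i \<trianglelefteq> \<one>"
  have iI: "i \<in> I" "\<one> \<trianglelefteq> i" using points_differ assms by blast+
  have "i = u"
    using iI i1 unit_coord coordD by (intro coords_antisym) (auto intro: ple_trans[of _ \<one>])
  hence odd: "is_odd" using assms by (auto simp: points_def split: if_splits)
  hence "\<not> i \<trianglelefteq> c" using assms unfolding dense_level_def visible_def by blast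
  thus False using i1 assms iI coordD ple_trans[of i \<one> c] by simp
qed

section \<open>Modifying points: coordinate updates and the shift\<close>

lemma finite_support_update:
  fixes x :: "'a \<Rightarrow> rat"
  assumes "finite {j. x j \<noteq> 0}"
  shows "finite {j. (x(i := q)) j \<noteq> 0}"
  by (rule finite_subset[of _ "insert i {j. x j \<noteq> 0}"]) (use assms in auto)

lemma points_update:
  assumes "x \<in> points" "i \<in> I" "\<one> \<trianglelefteq> i" "\<not> i \<trianglelefteq> \<one>"
  shows "x(i := q) \<in> points"
proof -
  have "i \<noteq> u" using assms unit_coord by auto
  with assms show ?thesis
    unfolding points_def using finite_support_update[of x i q] by (auto split: if_splits)
qed

lemma zero_point: "(\<lambda>_. 0) \<in> points"
  unfolding points_def by simp

lemma shift_points: "x \<in> points \<Longrightarrow> shift x \<in> points"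
  unfolding points_def shift_def
  using unit_coord finite_support_update[of x u "x u - 1"] by (auto split: if_splits)

lemma bij_shift: "bij_betw shift points points"
proof (rule bij_betw_byWitness)
  let ?g = "\<lambda>x. if is_odd then x(u := x u + 1) else x"
  show "\<forall>x \<in> points. ?g (shift x) = x" "\<forall>x \<in> points. shift (?g x) = x"
    by (auto simp: shift_def)
  show "shift ` points \<subseteq> points" using shift_points by blast
  show "?g ` points \<subseteq> points"
    unfolding points_def
    using unit_coord finite_support_update[of _ u] by (auto split: if_splits)
qed

text \<open>At a dense level the deciding coordinate and everything above it lie strictly above the
  unit, whereas the shift touches only \<open>u\<close>.\<close>

lemma slt_shift:
  assumes "x \<in> points" "y \<in> points" "c \<in> carrier A" "\<one> \<trianglelefteq> c" "dense_level c"
  shows "slt c (shift x) y \<longleftrightarrow> slt c x y" "slt c x (shift y) \<longleftrightarrow> slt c x y"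
proof -
  have agree: "shift z j = z j" if "\<not> j \<trianglelefteq> \<one>" for z j
    using that unit_coord by (auto simp: shift_def)
  have up: "\<not> j \<trianglelefteq> \<one>" if "\<not> j \<trianglelefteq> i" "\<not> i \<trianglelefteq> \<one>" "i \<in> I" "j \<in> I" for i j
    using that ple_total[of i j] ple_trans[of i j \<one>] coordD by auto
  \<comment> \<open>Each of \<open>x'\<close>, \<open>y'\<close> may be a shift or an unshift, so
    one fact serves both directions of both equivalences.\<close>
  have *: "lex_at x' y' i"
    if xy: "x \<in> points" "y \<in> points" and i: "visible c i" "lex_at x y i"
      and x': "x' = x \<or> x' = shift x \<or> x = shift x'" and y': "y' = y \<or> y' = shift y \<or> y = shift y'"
    for x y x' y' i
  proof -
    have n: "\<not> i \<trianglelefteq> \<one>"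
      using visible_dense_coord[OF xy assms(3-5) i(1)] i(2) unfolding lex_at_def by auto
    have "x' j = x j" "y' j = y j" if "\<not> j \<trianglelefteq> \<one>" for j
      using x' y' agree[OF that] by metis+
    thus ?thesis using i n up unfolding lex_at_def by auto
  qed
  show "slt c (shift x) y \<longleftrightarrow> slt c x y" "slt c x (shift y) \<longleftrightarrow> slt c x y"
    unfolding slt_def using *[of "shift x" y _ x y] *[of x y _ "shift x" y] *[of x "shift y" _ x y]
      *[of x y _ x "shift y"] shift_points assms by blast+
qed

text \<open>At the unit level of an odd chain all coordinates count and the order is total. The
  least significant coordinate is integral, so \<open>shift x\<close> is the immediate predecessor
  of \<open>x\<close>: being above \<open>shift x\<close> means being at or above
  \<open>x\<close>.\<close>

lemma slt_shift_unit:
  assumes "x \<in> points" "y \<in> points" "c \<trianglelefteq> \<one>" "d \<trianglelefteq> \<one>" is_odd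
  shows "slt c (shift x) y \<longleftrightarrow> \<not> slt d y x"
proof -
  have slt: "slt c' v w \<longleftrightarrow> (\<exists>i. lex_at v w i)" if "c' \<trianglelefteq> \<one>" for c' v w
    using that unfolding slt_def visible_def by blast
  have shift: "shift x j = (if j = u then x u - 1 else x j)" for j
    using assms by (simp add: shift_def)
  have above: "j \<noteq> u" if "i \<in> I" "\<one> \<trianglelefteq> i" "\<not> j \<trianglelefteq> i" for i j
    using that unit_coord ple_trans[of u \<one> i] coordD by auto
  have diff: "i \<in> I \<and> \<one> \<trianglelefteq> i" if "lex_at x y i \<or> lex_at y x i" for i
    using that points_differ[of x y i] assms unfolding lex_at_def by auto
  have lt: "\<exists>i. lex_at (shift x) y i" if "lex_at x y i" for i
    using that diff[of i] above[of i] shift unfolding lex_at_def by (intro exI[of _ i]) auto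
  have refl: "\<exists>i. lex_at (shift x) x i"
    using unit_coord shift by (intro exI[of _ u]) (auto simp: lex_at_def ple_refl coordD)
  \<comment> \<open>A point below \<open>x\<close> is at most \<open>shift x\<close>. Equality
    occurs exactly when the deciding coordinate is \<open>u\<close> and the gap is one; in the other
    cases the inequality survives the decrement, at \<open>u\<close> by integrality.\<close>
  have gt: "\<nexists>i. lex_at (shift x) y i" if i: "lex_at y x i" for i
  proof -
    have "(\<exists>i. lex_at y (shift x) i) \<or> shift x = y"
    proof (cases "i = u \<and> y u = x u - 1")
      case True
      have "shift x j = y j" for j
      proof (rule ccontr)
        assume ne: "shift x j \<noteq> y j"
        hence "j \<noteq> u" and "x j \<noteq> y j" using True shift by (auto split: if_splits)
        hence j: "j \<in> I" "\<one> \<trianglelefteq> j" using points_differ assms by blast+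
        with \<open>x j \<noteq> y j\<close> have "j \<trianglelefteq> u" using i True unfolding lex_at_def by auto
        moreover have "u \<trianglelefteq> j"
          using j unit_coord ple_trans[of u \<one> j] coordD by simp
        ultimately show False using \<open>j \<noteq> u\<close> j unit_coord coords_antisym by blast
      qed
      thus ?thesis by blast
    next
      case False
      have "y i < shift x i"
      proof (cases "i = u")
        case True
        have "x u \<in> \<int>" "y u \<in> \<int>" using assms by (auto simp: points_def)
        then obtain m n where "x u = of_int m" "y u = of_int n" by (auto elim!: Ints_cases)
        moreover have "y u < x u" "y u \<noteq> x u - 1" using i True False by (auto simp: lex_at_def)
        ultimately have "n < m" "n \<noteq> m - 1" by auto
        hence "n < m - 1" by linarith
        hence "y u < x u - 1"
          using \<open>x u = of_int m\<close> \<open>y u = of_int n\<close> by (metis of_int_1 of_int_diff of_int_less_iff)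
        thus ?thesis using True shift by simp
      qed (use i shift in \<open>simp add: lex_at_def\<close>)
      hence "lex_at y (shift x) i"
        using i diff[of i] above[of i] shift unfolding lex_at_def by auto
      thus ?thesis by blast
    qed
    thus ?thesis using lex_at_asym slt_irrefl[of \<one>] slt[of \<one>] by (auto simp: ple_refl)
  qed
  show ?thesis
  proof (cases "x = y")
    case True
    thus ?thesis using refl slt assms slt_irrefl by auto
  next
    case False
    hence "(\<exists>i. lex_at x y i) \<or> (\<exists>i. lex_at y x i)"
      using slt_total[of x y] assms slt[of \<one>] by (simp add: ple_refl)
    thus ?thesis using lt gt slt assms lex_at_asym by blast
  qed
qed

text \<open>The deciding coordinate is strictly above the unit, hence free to take the midpoint of
  its two rational values.\<close>

lemma slt_dense:
  assumes "x \<in> points" "z \<in> points" "c \<in> carrier A" "\<one> \<trianglelefteq> c" "dense_level c" "slt c x z"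
  shows "\<exists>y \<in> points. slt c x y \<and> slt c y z"
proof -
  obtain i where i: "visible c i" "lex_at x z i" using assms unfolding slt_def by blast
  have "i \<in> I" "x i < z i" using i unfolding lex_at_def by auto
  moreover have "\<one> \<trianglelefteq> i" "\<not> i \<trianglelefteq> \<one>"
    using points_differ(2)[of x z i] visible_dense_coord[of x z c i] assms i calculation by auto
  ultimately have y: "x(i := (x i + z i) / 2) \<in> points" (is "?y \<in> _")
    using points_update assms by blast
  have "lex_at x ?y i" "lex_at ?y z i"
    using i \<open>x i < z i\<close> by (auto simp: lex_at_def ple_refl coordD)
  thus ?thesis using i y unfolding slt_def by blast
qed

text \<open>The coordinate representing \<open>c\<close> itself is strictly above \<open>d\<close>,
  so changing it moves the point at level \<open>d\<close>. Level \<open>c\<close> reads only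
  coordinates strictly above \<open>c\<close> and does not notice the change.\<close>

lemma update_invisible_coord:
  assumes c: "c \<in> carrier A" and d: "d \<in> carrier A" "\<one> \<trianglelefteq> d" and nle: "\<not> c \<trianglelefteq> d"
    and z: "z \<in> points"
  obtains i where "\<And>q. z(i := q) \<in> points"
    "\<And>q. z i < q \<Longrightarrow> slt d z (z(i := q))" "\<And>q. q < z i \<Longrightarrow> slt d (z(i := q)) z"
    "\<And>q w. slt c (z(i := q)) w \<longleftrightarrow> slt c z w" "\<And>q w. slt c w (z(i := q)) \<longleftrightarrow> slt c w z"
proof -
  obtain i where i: "i \<in> I" "i \<trianglelefteq> c" "c \<trianglelefteq> i" using coords_represent c by blast
  note iC = coordD[OF i(1)]
  have c1: "\<not> c \<trianglelefteq> \<one>" using ple_trans[of c \<one> d] c d nle by auto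
  have i1: "\<not> i \<trianglelefteq> \<one>" using ple_trans[of c i \<one>] c iC c1 i by auto
  hence "\<one> \<trianglelefteq> i" using ple_total[of \<one> i] iC by auto
  hence pts: "z(i := q) \<in> points" for q using points_update z i i1 by blast
  have vis: "visible d i" unfolding visible_def using ple_trans[of c i d] c d iC i nle by auto
  have lex: "lex_at (z(i := q)) w k \<longleftrightarrow> lex_at z w k" "lex_at w (z(i := q)) k \<longleftrightarrow> lex_at w z k"
    if "visible c k" for k w q
  proof -
    have "\<not> k \<trianglelefteq> c" using that c1 by (simp add: visible_def)
    hence "k \<noteq> i" "k \<in> I \<Longrightarrow> i \<trianglelefteq> k"
      using i ple_total[of i k] ple_trans[of k i c] iC c coordD by auto
    thus "lex_at (z(i := q)) w k \<longleftrightarrow> lex_at z w k" "lex_at w (z(i := q)) k \<longleftrightarrow> lex_at w z k"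
      unfolding lex_at_def by auto
  qed
  show thesis
  proof (rule that[of i])
    show "slt d z (z(i := q))" if "z i < q" for q
      using that vis i unfolding slt_def lex_at_def by (intro exI[of _ i]) (auto simp: ple_refl coordD)
    show "slt d (z(i := q)) z" if "q < z i" for q
      using that vis i unfolding slt_def lex_at_def by (intro exI[of _ i]) (auto simp: ple_refl coordD)
  qed (use pts lex in \<open>auto simp: slt_def\<close>)
qed

section \<open>The relations attached to the elements of the algebra\<close>

lemma rel_pos: "\<one> \<trianglelefteq> a \<Longrightarrow> (x, y) \<in> rel a \<longleftrightarrow> x \<in> points \<and> y \<in> points \<and> \<not> slt a y x"
  unfolding rel_def by simp

lemma rel_neg:
  "\<not> \<one> \<trianglelefteq> a \<Longrightarrow> (x, y) \<in> rel a \<longleftrightarrow> x \<in> points \<and> y \<in> points \<and> slt (\<sim>a) x y"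
  unfolding rel_def by simp

text \<open>If the chain were odd and \<open>\<sim>a\<close> at most the unit, then \<open>a\<close>
  would be above \<open>\<sim>\<one>\<close> and hence above \<open>\<one>\<close>. So strict
  relations occur only at dense levels.\<close>

lemma neg_level:
  assumes "a \<in> carrier A" "\<not> \<one> \<trianglelefteq> a"
  shows "\<one> \<trianglelefteq> \<sim>a" "dense_level (\<sim>a)"
proof -
  show "\<one> \<trianglelefteq> \<sim>a" using one_ple_or_neg assms by blast
  have "\<one> \<trianglelefteq> a" if "\<one> \<trianglelefteq> \<sim>\<one>" "\<sim>a \<trianglelefteq> \<one>"
    using that neg_ple_neg_iff[of "\<sim>a" \<one>] ple_trans[of \<one> "\<sim>\<one>" a] assms
    by (simp add: inv_neg_inv_neg)
  thus "dense_level (\<sim>a)" using assms unfolding dense_level_def is_odd_def by blast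
qed

text \<open>Raising the level shrinks the strict order and enlarges the preorder. For opposite
  signs, asymmetry puts any strict order inside any preorder.\<close>

lemma rel_mono:
  assumes a: "a \<in> carrier A" and b: "b \<in> carrier A" and ab: "a \<trianglelefteq> b"
  shows "rel a \<subseteq> rel b"
proof (cases "\<one> \<trianglelefteq> a")
  case True
  hence "\<one> \<trianglelefteq> b" using ple_trans[of \<one> a b] a b ab by simp
  with True show ?thesis using slt_antimono a b ab by (auto simp: rel_pos)
next
  case False
  note na = this
  show ?thesis
  proof (cases "\<one> \<trianglelefteq> b")
    case True
    thus ?thesis using na slt_asym by (auto simp: rel_pos rel_neg)
  next
    case False
    have "\<sim>b \<trianglelefteq> \<sim>a" using neg_ple_neg_iff a b ab by simp
    thus ?thesis using na False slt_antimono[of "\<sim>a" _ _ "\<sim>b"] a b by (auto simp: rel_neg)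
  qed
qed

lemma rel_cong: "\<lbrakk>a \<in> carrier A; b \<in> carrier A; a \<trianglelefteq> b; b \<trianglelefteq> a\<rbrakk> \<Longrightarrow> rel a = rel b"
  using rel_mono by blast

text \<open>The product is equivalent to \<open>b\<close>, and the coarser transitive preorder
  absorbs the finer reflexive one.\<close>

lemma rel_mult_pos_pos:
  assumes a: "a \<in> carrier A" "\<one> \<trianglelefteq> a" and b: "b \<in> carrier A" and ab: "a \<trianglelefteq> b"
  shows "rel a O rel b = rel (a \<otimes> b)" "rel b O rel a = rel (a \<otimes> b)"
proof -
  have 1: "rel (a \<otimes> b) = rel b" using mult_pos_pos a b ab by (intro rel_cong) auto
  have b1: "\<one> \<trianglelefteq> b" using ple_trans[of \<one> a b] a b ab by simp
  have refl: "(x, x) \<in> rel a" if "x \<in> points" for x using that a slt_irrefl by (simp add: rel_pos)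
  have "rel b O rel b \<subseteq> rel b" using b b1 slt_cases by (fastforce simp: rel_pos)
  moreover have "rel a \<subseteq> rel b" using rel_mono a b ab by blast
  moreover have "rel b \<subseteq> points \<times> points" by (auto simp: rel_def)
  ultimately show "rel a O rel b = rel (a \<otimes> b)" "rel b O rel a = rel (a \<otimes> b)"
    unfolding 1 using refl by blast+
qed

text \<open>The comparison of \<open>a\<close> with \<open>\<sim>b\<close> decides which factor
  wins. A winning strict order absorbs the reflexive preorder; a winning preorder contains the
  compositions, and the converse needs a point moved at level \<open>\<sim>b\<close> only.\<close>

lemma rel_mult_pos_neg:
  assumes a: "a \<in> carrier A" "\<one> \<trianglelefteq> a" and b: "b \<in> carrier A" "\<not> \<one> \<trianglelefteq> b"
  shows "rel a O rel b = rel (a \<otimes> b)" "rel b O rel a = rel (a \<otimes> b)"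
proof -
  define d where "d = \<sim>b"
  have d: "d \<in> carrier A" "\<one> \<trianglelefteq> d" "b = \<sim>d"
    using neg_level b unfolding d_def by (simp_all add: inv_neg_inv_neg)
  have rb: "(x, y) \<in> rel b \<longleftrightarrow> x \<in> points \<and> y \<in> points \<and> slt d x y" for x y
    using b by (simp add: rel_neg d_def)
  show "rel a O rel b = rel (a \<otimes> b)" "rel b O rel a = rel (a \<otimes> b)"
  proof (atomize (full), cases "a \<trianglelefteq> d")
    case True
    have 1: "rel (a \<otimes> b) = rel b"
      unfolding d(3) using mult_pos_neg_dominated a d True by (intro rel_cong) auto
    have "(x, z) \<in> rel b" if "(x, y) \<in> rel a" "(y, z) \<in> rel b" for x y z
      using slt_weak_trans(1)[of x y z a d] a d(1) True that by (simp add: rel_pos rb)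
    moreover have "(x, z) \<in> rel b" if "(x, y) \<in> rel b" "(y, z) \<in> rel a" for x y z
      using slt_weak_trans(2)[of x y z a d] a d(1) True that by (simp add: rel_pos rb)
    ultimately have "rel a O rel b \<subseteq> rel b" "rel b O rel a \<subseteq> rel b"
      by blast+
    moreover have "rel b \<subseteq> points \<times> points" by (auto simp: rel_def)
    moreover have "(x, x) \<in> rel a" if "x \<in> points" for x using that a slt_irrefl by (simp add: rel_pos)
    ultimately show "rel a O rel b = rel (a \<otimes> b) \<and> rel b O rel a = rel (a \<otimes> b)"
      unfolding 1 by blast
  next
    case False
    have 1: "rel (a \<otimes> b) = rel a"
      unfolding d(3) using mult_pos_neg_dominating a d False by (intro rel_cong) auto
    have da: "d \<trianglelefteq> a" using ple_total a d False by blast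
    have "(x, z) \<in> rel a" if "(x, y) \<in> rel a" "(y, z) \<in> rel b" for x y z
      using slt_weak_trans(1)[of y z x d a] a d(1) da that slt_asym[of d y z] by (auto simp: rel_pos rb)
    moreover have "(x, z) \<in> rel a" if "(x, y) \<in> rel b" "(y, z) \<in> rel a" for x y z
      using slt_weak_trans(2)[of z x y d a] a d(1) da that slt_asym[of d x y] by (auto simp: rel_pos rb)
    ultimately have "rel a O rel b \<subseteq> rel a" "rel b O rel a \<subseteq> rel a"
      by blast+
    \<comment> \<open>Lowering \<open>z\<close>, or raising \<open>x\<close>, at a coordinate hidden
      from level \<open>a\<close> inserts a strict step at level \<open>d\<close> without affecting
      the preorder.\<close>
    moreover have "(x, z) \<in> rel a O rel b \<and> (x, z) \<in> rel b O rel a" if xz: "(x, z) \<in> rel a" for x z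
    proof
      have pts: "x \<in> points" "z \<in> points" "\<not> slt a z x" using xz a by (auto simp: rel_pos)
      obtain i where i: "\<And>q. z(i := q) \<in> points" "\<And>q. q < z i \<Longrightarrow> slt d (z(i := q)) z"
        "\<And>q w. slt a (z(i := q)) w \<longleftrightarrow> slt a z w"
        using update_invisible_coord[OF a(1) d(1,2) False pts(2)] by metis
      have "(x, z(i := z i - 1)) \<in> rel a" "(z(i := z i - 1), z) \<in> rel b"
        using i pts a by (simp_all add: rel_pos rb)
      thus "(x, z) \<in> rel a O rel b" by blast
      obtain i where i: "\<And>q. x(i := q) \<in> points" "\<And>q. x i < q \<Longrightarrow> slt d x (x(i := q))"
        "\<And>q w. slt a w (x(i := q)) \<longleftrightarrow> slt a w x"
        using update_invisible_coord[OF a(1) d(1,2) False pts(1)] by metis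
      have "(x, x(i := x i + 1)) \<in> rel b" "(x(i := x i + 1), z) \<in> rel a"
        using i pts a by (simp_all add: rel_pos rb)
      thus "(x, z) \<in> rel b O rel a" by blast
    qed
    ultimately show "rel a O rel b = rel (a \<otimes> b) \<and> rel b O rel a = rel (a \<otimes> b)"
      unfolding 1 by auto
  qed
qed

text \<open>The product is equivalent to \<open>a\<close>, whose strict order reads fewer
  coordinates and absorbs that of \<open>b\<close>. The converse inclusion is density, splitting a
  strict step of \<open>a\<close> into two, one of which is also a step of \<open>b\<close>.\<close>

lemma rel_mult_neg_neg:
  assumes a: "a \<in> carrier A" and b: "b \<in> carrier A" "\<not> \<one> \<trianglelefteq> b" and ab: "a \<trianglelefteq> b"
  shows "rel a O rel b = rel (a \<otimes> b)" "rel b O rel a = rel (a \<otimes> b)"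
proof -
  have na: "\<not> \<one> \<trianglelefteq> a" using ple_trans[of \<one> a b] a b ab by auto
  have "b \<trianglelefteq> \<one>" using ple_total[of b \<one>] b by auto
  hence 1: "rel (a \<otimes> b) = rel a" using mult_neg_neg a b ab by (intro rel_cong) auto
  have sub: "rel a \<subseteq> rel b" using rel_mono a b ab by blast
  have ba: "\<sim>b \<trianglelefteq> \<sim>a" using neg_ple_neg_iff a b ab by simp
  have "(x, z) \<in> rel a" if "(x, y) \<in> rel a" "(y, z) \<in> rel b" for x y z
    using slt_weak_trans(2)[of x y z "\<sim>b" "\<sim>a"] slt_asym[of "\<sim>b" y z] a b na ba that
    by (simp add: rel_neg)
  moreover have "(x, z) \<in> rel a" if "(x, y) \<in> rel b" "(y, z) \<in> rel a" for x y z
    using slt_weak_trans(1)[of x y z "\<sim>b" "\<sim>a"] slt_asym[of "\<sim>b" x y] a b na ba that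
    by (simp add: rel_neg)
  ultimately have "rel a O rel b \<subseteq> rel a" "rel b O rel a \<subseteq> rel a"
    by blast+
  moreover have "rel a \<subseteq> rel a O rel a"
    using slt_dense[of _ _ "\<sim>a"] neg_level[OF a na] a na by (fastforce simp: rel_neg)
  ultimately show "rel a O rel b = rel (a \<otimes> b)" "rel b O rel a = rel (a \<otimes> b)"
    unfolding 1 using sub by blast+
qed

lemma rel_mult:
  assumes "a \<in> carrier A" "b \<in> carrier A"
  shows "rel (a \<otimes> b) = rel a O rel b"
proof -
  \<comment> \<open>Treating both orders of composition at once permits assuming
    \<open>a \<trianglelefteq> b\<close>.\<close>
  have *: "rel a O rel b = rel (a \<otimes> b) \<and> rel b O rel a = rel (a \<otimes> b)"
    if ab: "a \<in> carrier A" "b \<in> carrier A" "a \<trianglelefteq> b" for a b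
  proof (cases "\<one> \<trianglelefteq> a")
    case True
    thus ?thesis using rel_mult_pos_pos[OF ab(1) _ ab(2,3)] by blast
  next
    case False
    note na = this
    show ?thesis
    proof (cases "\<one> \<trianglelefteq> b")
      case True
      with ab na rel_mult_pos_neg[of b a] show ?thesis
        unfolding m_comm[OF ab(2,1)] by blast
    next
      case False
      thus ?thesis using rel_mult_neg_neg[OF ab(1,2) _ ab(3)] by blast
    qed
  qed
  from ple_total[OF assms] show ?thesis
  proof
    assume "b \<trianglelefteq> a"
    with *[of b a] assms show ?thesis unfolding m_comm[OF assms(2,1)] by blast
  qed (use * assms in blast)
qed

lemma rel_meet_join:
  assumes "a \<in> carrier A" "b \<in> carrier A"
  shows "rel (a \<curlywedge> b) = rel a \<inter> rel b" "rel (a \<curlyvee> b) = rel a \<union> rel b"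
proof -
  have *: "rel (a \<curlywedge> b) = rel a \<inter> rel b \<and> rel (a \<curlyvee> b) = rel a \<union> rel b"
    if ab: "a \<in> carrier A" "b \<in> carrier A" "a \<trianglelefteq> b" for a b
  proof -
    have "rel (a \<curlywedge> b) = rel a"
      using ab ple_meet_and_join[OF ab] by (intro rel_cong) (simp_all add: ple_if_le meet_le1)
    moreover have "rel (a \<curlyvee> b) = rel b"
      using ab ple_meet_and_join[OF ab] by (intro rel_cong) (simp_all add: ple_if_le le_join2)
    ultimately show ?thesis using rel_mono[OF ab] by auto
  qed
  show "rel (a \<curlywedge> b) = rel a \<inter> rel b" "rel (a \<curlyvee> b) = rel a \<union> rel b"
    using ple_total[of a b] *[of a b] *[of b a] assms by (auto simp: meet_comm join_comm)
qed

text \<open>If \<open>a\<close> and \<open>\<sim>a\<close> are both positive, both are equivalent to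
  the unit, the chain is odd and the predecessor property of the shift applies. Otherwise one of the
  two relations is the complement of the converse of the other, at a dense level where the shift is
  invisible.\<close>

lemma rel_inv_neg:
  assumes a: "a \<in> carrier A" and xy: "x \<in> points" "y \<in> points"
  shows "(x, y) \<in> rel (\<sim>a) \<longleftrightarrow> (y, shift x) \<notin> rel a"
    and "(x, shift y) \<in> rel (\<sim>a) \<longleftrightarrow> (y, x) \<notin> rel a"
proof -
  have nn: "\<sim>\<sim>a = a" using a by (rule inv_neg_inv_neg)
  note pts = xy shift_points[OF xy(1)] shift_points[OF xy(2)]
  have "((x, y) \<in> rel (\<sim>a) \<longleftrightarrow> (y, shift x) \<notin> rel a) \<and>
    ((x, shift y) \<in> rel (\<sim>a) \<longleftrightarrow> (y, x) \<notin> rel a)"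
  proof (cases "\<one> \<trianglelefteq> a")
    case True
    note pa = this
    show ?thesis
    proof (cases "\<one> \<trianglelefteq> \<sim>a")
      case True
      have na: "\<sim>a \<trianglelefteq> \<one>" using neg_ple_one a pa by blast
      have a1: "a \<trianglelefteq> \<one>" using neg_ple_one[of "\<sim>a"] a True nn by simp
      have "\<sim>a \<trianglelefteq> \<sim>\<one>" using neg_ple_neg_iff[of \<one> a] pa a by simp
      hence "is_odd" unfolding is_odd_def using True ple_trans[of \<one> "\<sim>a" "\<sim>\<one>"] a by simp
      thus ?thesis
        using slt_shift_unit[OF xy(1,2) a1 na] slt_shift_unit[OF xy(2,1) na a1] pa True pts
        by (simp add: rel_pos)
    next
      case False
      have "dense_level a" using neg_level(2)[of "\<sim>a"] False a nn by simp
      thus ?thesis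
        using slt_shift[OF _ _ a pa] pa False pts nn by (simp add: rel_pos rel_neg)
    qed
  next
    case False
    note neg_level[OF a False]
    thus ?thesis
      using slt_shift[of _ _ "\<sim>a"] False pts a by (simp add: rel_pos rel_neg)
  qed
  thus "(x, y) \<in> rel (\<sim>a) \<longleftrightarrow> (y, shift x) \<notin> rel a" "(x, shift y) \<in> rel (\<sim>a) \<longleftrightarrow> (y, x) \<notin> rel a"
    by blast+
qed

text \<open>The diagonal separates elements of different sign. For equal signs, the origin and a
  point lowered at a coordinate seen by only one of the two levels do.\<close>

lemma rel_separates:
  assumes a: "a \<in> carrier A" and b: "b \<in> carrier A" and nle: "\<not> a \<trianglelefteq> b"
  shows "rel a \<noteq> rel b"
proof -
  let ?z = "\<lambda>_. 0 :: rat"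
  have ba: "b \<trianglelefteq> a" using ple_total a b nle by blast
  consider "\<one> \<trianglelefteq> b" "\<one> \<trianglelefteq> a" | "\<not> \<one> \<trianglelefteq> b" "\<one> \<trianglelefteq> a" | "\<not> \<one> \<trianglelefteq> b" "\<not> \<one> \<trianglelefteq> a"
    using ple_trans[of \<one> b a] a b ba by auto
  thus ?thesis
  proof cases
    case 1
    obtain i where i: "\<And>q. ?z(i := q) \<in> points" "\<And>q. q < ?z i \<Longrightarrow> slt b (?z(i := q)) ?z"
      "\<And>q w. slt a (?z(i := q)) w \<longleftrightarrow> slt a ?z w"
      using update_invisible_coord[OF a b 1(1) nle zero_point] by metis
    have "(?z, ?z(i := -1)) \<in> rel a" "(?z, ?z(i := -1)) \<notin> rel b"
      using i 1 zero_point slt_irrefl by (auto simp: rel_pos)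
    thus ?thesis by blast
  next
    case 2
    have "(?z, ?z) \<in> rel a" "(?z, ?z) \<notin> rel b"
      using 2 zero_point slt_irrefl by (auto simp: rel_pos rel_neg)
    thus ?thesis by blast
  next
    case 3
    have nle': "\<not> \<sim>b \<trianglelefteq> \<sim>a" using neg_ple_neg_iff a b nle by simp
    obtain i where i: "\<And>q. ?z(i := q) \<in> points" "\<And>q. q < ?z i \<Longrightarrow> slt (\<sim>a) (?z(i := q)) ?z"
      "\<And>q w. slt (\<sim>b) (?z(i := q)) w \<longleftrightarrow> slt (\<sim>b) ?z w"
      using update_invisible_coord[OF _ _ neg_level(1)[OF a 3(2)] nle' zero_point] a b
      by (metis inv_neg_closed)
    have "(?z(i := -1), ?z) \<in> rel a" "(?z(i := -1), ?z) \<notin> rel b"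
      using i 3 zero_point slt_irrefl by (auto simp: rel_neg)
    thus ?thesis by blast
  qed
qed

lemma sugihara_relational_rep_rel:
  "sugihara_relational_rep A points (points \<times> points) shift rel"
proof unfold_locales
  show "equiv points (points \<times> points)"
    by (auto simp: equiv_def refl_on_def sym_def trans_def)
  show "antisym (rel \<one>)"
  proof (rule antisymI)
    show "x = y" if "(x, y) \<in> rel \<one>" "(y, x) \<in> rel \<one>" for x y
      using that slt_total[of x y] by (auto simp: rel_pos ple_refl)
  qed
  show "(x, x) \<in> rel \<one>" if "x \<in> points" for x
    using that by (simp add: rel_pos ple_refl slt_irrefl)
  show "(x, shift x) \<in> points \<times> points" if "x \<in> points" for x
    using that shift_points by blast
  show "rel a \<subseteq> points \<times> points" for a
    by (auto simp: rel_def)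
  fix a assume "a \<in> carrier A"
  thus "(x, y) \<in> rel (\<sim>a) \<longleftrightarrow> (y, shift x) \<notin> rel a" "(x, shift y) \<in> rel (\<sim>a) \<longleftrightarrow> (y, x) \<notin> rel a"
    if "(x, y) \<in> points \<times> points" for x y
    using rel_inv_neg that by blast+
qed (fact bij_shift rel_mult rel_meet_join)+

end

section \<open>Choice of coordinates, separation and encoding of points\<close>

lemma (in sugihara_chain) ex_coords: "\<exists>I u. sugihara_chain_coords A F I u"
proof -
  define r where "r c = (SOME d. d \<in> carrier A \<and> d \<trianglelefteq> c \<and> c \<trianglelefteq> d)" for c
  have r: "r c \<in> carrier A" "r c \<trianglelefteq> c" "c \<trianglelefteq> r c" if "c \<in> carrier A" for c
    using someI[of "\<lambda>d. d \<in> carrier A \<and> d \<trianglelefteq> c \<and> c \<trianglelefteq> d" c] that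
    unfolding r_def[symmetric] by (auto simp: ple_refl)
  \<comment> \<open>The predicate under the choice operator depends only on the class of
    \<open>c\<close>, so equivalent elements receive the same representative.\<close>
  have r_eq: "r c = r d" if cd: "c \<in> carrier A" "d \<in> carrier A" "r c \<trianglelefteq> r d" "r d \<trianglelefteq> r c" for c d
  proof -
    have "c \<trianglelefteq> d" "d \<trianglelefteq> c" using cd r by (meson ple_trans)+
    hence "(e \<in> carrier A \<and> e \<trianglelefteq> c \<and> c \<trianglelefteq> e) = (e \<in> carrier A \<and> e \<trianglelefteq> d \<and> d \<trianglelefteq> e)" for e
      using cd ple_trans by blast
    thus ?thesis unfolding r_def by simp
  qed
  have "sugihara_chain_coords A F (r ` carrier A) (r \<one>)"
    by unfold_locales (use r r_eq in auto)
  thus ?thesis by blast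
qed

text \<open>As \<open>\<one> \<preceq> a \<leadsto> b\<close> fails, a prime filter omits
  \<open>a \<leadsto> b\<close>, and the relations of its chain differ. The finite supports are
  recorded for the encoding by lists.\<close>

lemma (in sugihara_monoid) ex_separating_rep:
  assumes a: "a \<in> carrier A" and b: "b \<in> carrier A" and nle: "\<not> a \<preceq> b"
  shows "\<exists>X \<alpha> h. sugihara_relational_rep A X (X \<times> X) \<alpha> h \<and> h a \<noteq> h b \<and>
    (\<forall>x \<in> X. finite {i :: 'a. x i \<noteq> (0 :: rat)})"
proof -
  obtain F where F: "prime_filter A F" "a \<leadsto> b \<notin> F"
    using ex_prime_filter[of "a \<leadsto> b"] one_le_imp_iff[OF a b] imp_closed[OF a b] nle by auto
  interpret sugihara_chain A F by unfold_locales (rule F)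
  obtain I u where "sugihara_chain_coords A F I u" using ex_coords by blast
  then interpret sugihara_chain_coords A F I u .
  have "rel a \<noteq> rel b" using rel_separates a b F by (simp add: ple_def)
  moreover have "\<forall>x \<in> points. finite {i. x i \<noteq> 0}" by (simp add: points_def)
  ultimately show ?thesis using sugihara_relational_rep_rel by blast
qed

text \<open>The two leading entries hold the index pair, padded with 0. The tail lists the graph of
  the function on its support, with rationals coded as naturals; its set recovers the function when
  the support is finite.\<close>

definition encode_point :: "('a \<times> 'a) \<times> ('a \<Rightarrow> rat) \<Rightarrow> ('a \<times> nat) list" where
  "encode_point p = (fst (fst p), 0) # (snd (fst p), 0) #
     (SOME l. set l = (\<lambda>i. (i, to_nat (snd p i))) ` {i. snd p i \<noteq> 0})"

lemma inj_on_encode_point: "inj_on encode_point {p. finite {i. snd p i \<noteq> 0}}"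
proof (rule inj_onI)
  fix p q :: "('a \<times> 'a) \<times> ('a \<Rightarrow> rat)"
  let ?G = "\<lambda>x :: 'a \<Rightarrow> rat. (\<lambda>i. (i, to_nat (x i))) ` {i. x i \<noteq> 0}"
  assume fin: "p \<in> {p. finite {i. snd p i \<noteq> 0}}" "q \<in> {p. finite {i. snd p i \<noteq> 0}}"
    and eq: "encode_point p = encode_point q"
  have set_some: "set (SOME l. set l = ?G x) = ?G x" if "finite {i. x i \<noteq> 0}" for x
    using someI_ex[OF finite_list[of "?G x"]] that by simp
  have "(SOME l. set l = ?G (snd p)) = (SOME l. set l = ?G (snd q))"
    using eq unfolding encode_point_def by (meson list.inject)
  moreover have "finite {i. snd p i \<noteq> 0}" "finite {i. snd q i \<noteq> 0}" using fin by auto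
  ultimately have eqG: "?G (snd p) = ?G (snd q)"
    using set_some[of "snd p"] set_some[of "snd q"] by argo
  have mem: "(i, n) \<in> ?G x \<longleftrightarrow> x i \<noteq> 0 \<and> n = to_nat (x i)" for i n x by auto
  have G: "snd p i \<noteq> 0 \<and> n = to_nat (snd p i) \<longleftrightarrow> snd q i \<noteq> 0 \<and> n = to_nat (snd q i)"
    for i n using eqG unfolding mem[symmetric] by simp
  have "snd p i = snd q i" for i
    using G[of i "to_nat (snd p i)"] G[of i "to_nat (snd q i)"] by (cases "snd p i = 0") auto
  hence "snd p = snd q" by blast
  moreover have "fst p = fst q" using eq unfolding encode_point_def by (simp add: prod_eq_iff)
  ultimately show "p = q" by (simp add: prod_eq_iff)
qed

theorem theorem4p12:
  fixes A :: "'a sugihara_sig"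
  assumes "sugihara_monoid A"
  shows "sugihara_representable A"
proof -
  interpret sugihara_monoid A by (rule assms)
  define J where "J = {(a, b). a \<in> carrier A \<and> b \<in> carrier A \<and> \<not> a \<preceq>\<^bsub>A\<^esub> b}"
  have "\<forall>j \<in> J. \<exists>X \<alpha> h. sugihara_relational_rep A X (X \<times> X) \<alpha> h \<and> h (fst j) \<noteq> h (snd j) \<and>
    (\<forall>x \<in> X. finite {i :: 'a. x i \<noteq> (0 :: rat)})"
    using ex_separating_rep unfolding J_def by auto
  then obtain X \<alpha> h where rep: "\<And>j. j \<in> J \<Longrightarrow> sugihara_relational_rep A (X j) (X j \<times> X j) (\<alpha> j) (h j)"
    and sep: "\<And>j. j \<in> J \<Longrightarrow> h j (fst j) \<noteq> h j (snd j)"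
    and fin: "\<And>j x. \<lbrakk>j \<in> J; x \<in> X j\<rbrakk> \<Longrightarrow> finite {i :: 'a. x i \<noteq> (0 :: rat)}"
    by metis
  \<comment> \<open>The disjoint union is moved into the list type fixed by
    \<open>representable\<close>, and \<open>d\<close> decodes it.\<close>
  define P where "P = encode_point ` Sigma J X"
  define d where "d = inv_into (Sigma J X) encode_point"
  have "inj_on encode_point (Sigma J X)"
    by (rule inj_on_subset[OF inj_on_encode_point]) (use fin in auto)
  hence d: "bij_betw d P (Sigma J X)"
    unfolding P_def d_def by (intro bij_betw_inv_into inj_on_imp_bij_betw)
  define H where "H a = {(p, q) \<in> P \<times> P. fst (d p) = fst (d q) \<and>
    (snd (d p), snd (d q)) \<in> h (fst (d p)) a}" for a
  obtain E \<beta> where "sugihara_relational_rep A P E \<beta> H"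
    unfolding H_def using sugihara_relational_rep_sum[OF rep d] by blast
  then interpret sum: sugihara_relational_rep A P E \<beta> H .
  \<comment> \<open>The pairs of \<open>H a\<close> in summand \<open>j\<close> decode to
    \<open>h j a\<close>, so \<open>H a\<close> determines every component.\<close>
  have H: "h j a = {(x, y) | x y p q. (p, q) \<in> H a \<and> d p = (j, x) \<and> d q = (j, y)}"
    if j: "j \<in> J" and a: "a \<in> carrier A" for j a
  proof -
    have surj: "\<exists>p \<in> P. d p = (j, x)" if "x \<in> X j" for x
    proof -
      have "(j, x) \<in> d ` P" using bij_betw_imp_surj_on[OF d] j that by simp
      thus ?thesis by force
    qed
    have "\<exists>p q. (p, q) \<in> H a \<and> d p = (j, x) \<and> d q = (j, y)" if xy: "(x, y) \<in> h j a" for x y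
    proof -
      have "x \<in> X j" "y \<in> X j" using sugihara_relational_rep.rep_sub[OF rep[OF j] a] xy by auto
      then obtain p q where "p \<in> P" "d p = (j, x)" "q \<in> P" "d q = (j, y)" using surj by metis
      with xy have "(p, q) \<in> H a" by (simp add: H_def)
      with \<open>d p = _\<close> \<open>d q = _\<close> show ?thesis by blast
    qed
    thus ?thesis by (auto simp: H_def)
  qed
  have "inj_on H (carrier A)"
  proof (rule inj_onI, rule ccontr)
    fix a b assume ab: "a \<in> carrier A" "b \<in> carrier A" "H a = H b" "a \<noteq> b"
    \<comment> \<open>By antisymmetry two distinct elements fail to be ordered in at least one
      direction, which supplies a separating summand.\<close>
    hence "(a, b) \<in> J \<or> (b, a) \<in> J" using le_antisym unfolding J_def by blast
    thus False using sep H ab by fastforce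
  qed
  hence "representable (cyclic_dinfl A)"
    unfolding representable_def by (rule sum.representable_over_cyclic_dinfl)
  thus ?thesis unfolding sugihara_representable_def using sugihara_iso_cyclic_dinfl by blast
qed

end
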